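(* Suppose $z\in I_n$ and $D\subseteq[n]\times[n]$. The following are equivalent: (a) Some reading word of $D$ is an involution word for $z$. (b) Every reading word of $D$ is an involution word for $z$. (c) The set $D$ is a reduced pipe dream for some atom of $z$. Moreover, if $D\subseteq\{(j,i)\in[n]\times[n]:i\le j\}$, then $D\in\mathcal{ID}(z)$ if and only if these equivalent conditions hold.
   Context: $n$ is a fixed positive integer, $[n]=\{1,\dots,n\}$; $S_n$ is the group of permutations of $\mathbb Z_{>0}$ fixing all $i>n$, $s_i=(i,i+1)$, $\ell$ is Coxeter length, $I_n=\{w\in S_n:w=w^{-1}\}$. **Involution words and atoms.** The Demazure product $\circ$ is the unique associative operation on $S_n$ with $s_i\circ s_i=s_i$ and $v\circ w=vw$ whenever $\ell(vw)=\ell(v)+\ell(w)$. An involution word for $z\in I_n$ is a minimal-length word $a_1a_2\cdots a_l$ with letters in $[n-1]$ and $z=s_{a_l}\circ\cdots\circ s_{a_1}\circ1\circ s_{a_1}\circ\cdots\circ s_{a_l}$. An atom for $z$ is a minimal-length $w\in S_n$ with $z=w^{-1}\circ w$. **Reading words.** Let $\le_{\mathsf{NE}}$ be the partial order on $[n]\times[n]$ with $(i,j)\le_{\mathsf{NE}}(i',j')$ iff $i\le i'$ and $j\ge j'$. A reading order is a linear extension of it, i.e. a bijection $\omega:[n]\times[n]\to[n^2]$ with $\omega(s)<\omega(t)$ whenever $s<_{\mathsf{NE}}t$. If $\omega(D)=\{i_1<\cdots<i_m\}$, the associated reading word of $D$ is $a_1\cdots a_m$ where $a_k=p+q-1$ for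 $(p,q)=\omega^{-1}(i_k)$. **Pipe dreams.** Positions $(i,j)$ are in matrix coordinates. For $D\subseteq\{(i,j)\in[n]\times[n]:i+j\le n\}$ the wiring diagram of $D$ is drawn as follows: in a cell $(i,j)\in D$ one path joins the left edge to the right edge and another joins the bottom edge to the top edge (they cross); in a cell $(i,j)\notin D$ with $i+j\le n$ one path joins left to top and another joins bottom to right (they avoid each other); in a cell with $i+j=n+1$ a single path joins left to top. Connecting these gives $n$ pipes. $D$ is a reduced pipe dream if no two pipes cross more than once; it is a reduced pipe dream for $w\in S_n$ if, labeling left endpoints $1,\dots,n$ from top to bottom and top endpoints $1,\dots,n$ from left to right, the pipe with left endpoint $i$ has top endpoint $w(i)$ for each $i$. $\mathcal{PD}(w)$ is the set of these. A reduced pipe dream $D$ is almost-symmetric if (1) whenever $(i,j)\in D$ with $i<j$, also $(j,i)\in D$; and (2) whenever $(j,i)\in D$ with $i<j$ but $(i,j)\notin D$, the two pipes crossing at $(j,i)$ are also the two pipes that avoid each other at $(i,j)$. Finally, $\mathcal{ID}(z)=\{D\cap\{(j,i)\in[n]\times[n]:i\le j\}:D\in\mathcal{PD}(z)\text{ almost-symmetric}\}$. *)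

theory Defs
  imports "HOL-Combinatorics.Permutations"
begin

text \<open>A permutation of the positive integers fixing all \<open>i > n\<close> is represented by a function on
  \<^typ>\<open>nat\<close> that \<^const>\<open>permutes\<close> \<open>{1..n}\<close>, so it fixes 0 as well. The group product \<open>vw\<close> is
  composition \<open>v \<circ> w\<close>.\<close>

definition Sym :: "nat \<Rightarrow> (nat \<Rightarrow> nat) set" where
  "Sym n = {w. w permutes {1..n}}"

definition Invol :: "nat \<Rightarrow> (nat \<Rightarrow> nat) set" where
  "Invol n = {w \<in> Sym n. w = inv w}"

definition simple_refl :: "nat \<Rightarrow> nat \<Rightarrow> nat" where
  "simple_refl i = transpose i (Suc i)"

definition word_prod :: "nat list \<Rightarrow> nat \<Rightarrow> nat" where
  "word_prod as = foldr (\<lambda>a w. simple_refl a \<circ> w) as id"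

definition cox_length :: "nat \<Rightarrow> (nat \<Rightarrow> nat) \<Rightarrow> nat" where
  "cox_length n w = (LEAST k. \<exists>as. length as = k \<and> set as \<subseteq> {1..<n} \<and> word_prod as = w)"

definition is_demazure_product ::
    "nat \<Rightarrow> ((nat \<Rightarrow> nat) \<Rightarrow> (nat \<Rightarrow> nat) \<Rightarrow> (nat \<Rightarrow> nat)) \<Rightarrow> bool" where
  "is_demazure_product n f \<longleftrightarrow>
     (\<forall>v\<in>Sym n. \<forall>w\<in>Sym n. f v w \<in> Sym n) \<and>
     (\<forall>u\<in>Sym n. \<forall>v\<in>Sym n. \<forall>w\<in>Sym n. f (f u v) w = f u (f v w)) \<and>
     (\<forall>i\<in>{1..<n}. f (simple_refl i) (simple_refl i) = simple_refl i) \<and>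
     (\<forall>v\<in>Sym n. \<forall>w\<in>Sym n.
        cox_length n (v \<circ> w) = cox_length n v + cox_length n w \<longrightarrow> f v w = v \<circ> w)"

text \<open>The operation is unique only on \<open>Sym n\<close>, so the description is of the value at
  \<open>(v, w)\<close> rather than of the operation; it is meaningful for \<open>v\<close>, \<open>w\<close> in \<open>Sym n\<close>.\<close>

definition demazure :: "nat \<Rightarrow> (nat \<Rightarrow> nat) \<Rightarrow> (nat \<Rightarrow> nat) \<Rightarrow> (nat \<Rightarrow> nat)" where
  "demazure n v w = (THE u. \<exists>f. is_demazure_product n f \<and> f v w = u)"

text \<open>For \<open>as = [a\<^sub>1, \<dots>, a\<^sub>l]\<close> this is the Demazure product of
  \<open>s(a\<^sub>l), \<dots>, s(a\<^sub>1), 1, s(a\<^sub>1), \<dots>, s(a\<^sub>l)\<close>, bracketed from the middle outwards.\<close>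

definition demazure_conj :: "nat \<Rightarrow> nat list \<Rightarrow> nat \<Rightarrow> nat" where
  "demazure_conj n as =
     foldl (\<lambda>y a. demazure n (demazure n (simple_refl a) y) (simple_refl a)) id as"

definition involution_word :: "nat \<Rightarrow> (nat \<Rightarrow> nat) \<Rightarrow> nat list \<Rightarrow> bool" where
  "involution_word n z as \<longleftrightarrow>
     set as \<subseteq> {1..<n} \<and> z = demazure_conj n as \<and>
     (\<forall>bs. set bs \<subseteq> {1..<n} \<and> z = demazure_conj n bs \<longrightarrow> length as \<le> length bs)"

definition atom :: "nat \<Rightarrow> (nat \<Rightarrow> nat) \<Rightarrow> (nat \<Rightarrow> nat) \<Rightarrow> bool" where
  "atom n z w \<longleftrightarrow>
     w \<in> Sym n \<and> z = demazure n (inv w) w \<and>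
     (\<forall>v\<in>Sym n. z = demazure n (inv v) v \<longrightarrow> cox_length n w \<le> cox_length n v)"

definition grid :: "nat \<Rightarrow> (nat \<times> nat) set" where
  "grid n = {1..n} \<times> {1..n}"

definition le_NE :: "nat \<times> nat \<Rightarrow> nat \<times> nat \<Rightarrow> bool" where
  "le_NE s t \<longleftrightarrow> fst s \<le> fst t \<and> snd s \<ge> snd t"

definition reading_order :: "nat \<Rightarrow> (nat \<times> nat \<Rightarrow> nat) \<Rightarrow> bool" where
  "reading_order n \<omega> \<longleftrightarrow>
     bij_betw \<omega> (grid n) {1..n^2} \<and>
     (\<forall>s\<in>grid n. \<forall>t\<in>grid n. le_NE s t \<and> s \<noteq> t \<longrightarrow> \<omega> s < \<omega> t)"

definition reading_word :: "nat \<Rightarrow> (nat \<times> nat \<Rightarrow> nat) \<Rightarrow> (nat \<times> nat) set \<Rightarrow> nat list" where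
  "reading_word n \<omega> D =
     map (\<lambda>k. case inv_into (grid n) \<omega> k of (p, q) \<Rightarrow> p + q - 1) (sorted_list_of_set (\<omega> ` D))"

text \<open>The edges of the cells, in matrix coordinates: \<open>LeftEdge i j\<close> and \<open>TopEdge i j\<close> are the left
  and top edge of the cell \<open>(i, j)\<close>. Thus the right edge of \<open>(i, j)\<close> is \<open>LeftEdge i (j + 1)\<close> and its
  bottom edge is \<open>TopEdge (i + 1) j\<close>.\<close>

datatype edge = LeftEdge nat nat | TopEdge nat nat

text \<open>The paths drawn inside the single cells, each directed from the left or bottom edge of its
  cell to the top or right edge.\<close>

inductive wire :: "nat \<Rightarrow> (nat \<times> nat) set \<Rightarrow> edge \<Rightarrow> edge \<Rightarrow> bool" for n D where
  cross_horizontal: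
    "(i, j) \<in> D \<Longrightarrow> (i, j) \<in> grid n \<Longrightarrow> i + j \<le> n \<Longrightarrow>
       wire n D (LeftEdge i j) (LeftEdge i (j + 1))"
| cross_vertical:
    "(i, j) \<in> D \<Longrightarrow> (i, j) \<in> grid n \<Longrightarrow> i + j \<le> n \<Longrightarrow>
       wire n D (TopEdge (i + 1) j) (TopEdge i j)"
| avoid_left_top:
    "(i, j) \<notin> D \<Longrightarrow> (i, j) \<in> grid n \<Longrightarrow> i + j \<le> n \<Longrightarrow>
       wire n D (LeftEdge i j) (TopEdge i j)"
| avoid_bottom_right:
    "(i, j) \<notin> D \<Longrightarrow> (i, j) \<in> grid n \<Longrightarrow> i + j \<le> n \<Longrightarrow>
       wire n D (TopEdge (i + 1) j) (LeftEdge i (j + 1))"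
| boundary:
    "(i, j) \<in> grid n \<Longrightarrow> i + j = n + 1 \<Longrightarrow>
       wire n D (LeftEdge i j) (TopEdge i j)"

text \<open>Pipes are named by their left endpoints \<open>k \<in> {1..n}\<close> and given as the set of edges they pass
  through.\<close>

definition pipe :: "nat \<Rightarrow> (nat \<times> nat) set \<Rightarrow> nat \<Rightarrow> edge set" where
  "pipe n D k = {e. (wire n D)\<^sup>*\<^sup>* (LeftEdge k 1) e}"

text \<open>In a cell \<open>(i, j)\<close> with \<open>i + j \<le> n\<close>, crossing or not, one of the two paths starts on the left
  edge and the other one on the bottom edge.\<close>

definition pipes_meet :: "nat \<Rightarrow> (nat \<times> nat) set \<Rightarrow> nat \<Rightarrow> nat \<Rightarrow> nat \<times> nat \<Rightarrow> bool" where
  "pipes_meet n D p q c \<longleftrightarrow> (case c of (i, j) \<Rightarrow>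
     (i, j) \<in> grid n \<and> i + j \<le> n \<and>
     (LeftEdge i j \<in> pipe n D p \<and> TopEdge (i + 1) j \<in> pipe n D q \<or>
      LeftEdge i j \<in> pipe n D q \<and> TopEdge (i + 1) j \<in> pipe n D p))"

definition pipes_cross :: "nat \<Rightarrow> (nat \<times> nat) set \<Rightarrow> nat \<Rightarrow> nat \<Rightarrow> nat \<times> nat \<Rightarrow> bool" where
  "pipes_cross n D p q c \<longleftrightarrow> c \<in> D \<and> pipes_meet n D p q c"

definition pipes_avoid :: "nat \<Rightarrow> (nat \<times> nat) set \<Rightarrow> nat \<Rightarrow> nat \<Rightarrow> nat \<times> nat \<Rightarrow> bool" where
  "pipes_avoid n D p q c \<longleftrightarrow> c \<notin> D \<and> pipes_meet n D p q c"

definition reduced_pipe_dream :: "nat \<Rightarrow> (nat \<times> nat) set \<Rightarrow> bool" where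
  "reduced_pipe_dream n D \<longleftrightarrow>
     D \<subseteq> {(i, j) \<in> grid n. i + j \<le> n} \<and>
     (\<forall>p\<in>{1..n}. \<forall>q\<in>{1..n}. p \<noteq> q \<longrightarrow> card {c. pipes_cross n D p q c} \<le> 1)"

definition PD :: "nat \<Rightarrow> (nat \<Rightarrow> nat) \<Rightarrow> (nat \<times> nat) set set" where
  "PD n w = {D. reduced_pipe_dream n D \<and> (\<forall>i\<in>{1..n}. TopEdge 1 (w i) \<in> pipe n D i)}"

text \<open>Exactly two pipes meet in each cell \<open>(i, j)\<close> with \<open>i + j \<le> n\<close>, so the implication below
  says that the pair crossing at \<open>(j, i)\<close> is the pair avoiding each other at \<open>(i, j)\<close>.\<close>

definition almost_symmetric :: "nat \<Rightarrow> (nat \<times> nat) set \<Rightarrow> bool" where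
  "almost_symmetric n D \<longleftrightarrow>
     (\<forall>i j. (i, j) \<in> D \<and> i < j \<longrightarrow> (j, i) \<in> D) \<and>
     (\<forall>i j. (j, i) \<in> D \<and> i < j \<and> (i, j) \<notin> D \<longrightarrow>
        (\<forall>p\<in>{1..n}. \<forall>q\<in>{1..n}. pipes_cross n D p q (j, i) \<longrightarrow> pipes_avoid n D p q (i, j)))"

definition lower_triangle :: "nat \<Rightarrow> (nat \<times> nat) set" where
  "lower_triangle n = {(j, i) \<in> grid n. i \<le> j}"

definition ID :: "nat \<Rightarrow> (nat \<Rightarrow> nat) \<Rightarrow> (nat \<times> nat) set set" where
  "ID n z = {D \<inter> lower_triangle n | D. D \<in> PD n z \<and> almost_symmetric n D}"

end

theory Submission
  imports Defs
begin

text \<open>Every reduced pipe dream is scanned by moving a lattice path from the left boundary to the top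
  boundary; the pipe met by the \<open>k\<close>-th edge of the path is determined by the suffix of the
  reading word seen so far, whichever reading order is used. So \<open>D\<close> is a reduced pipe dream for
  \<open>w\<close> if and only if its reading word is a reduced word for \<open>w\<close>, and the involution words of
  \<open>z\<close> are the reduced words of its atoms.

  For the lower triangular case use a reading order that is symmetric about the diagonal and build
  \<open>z\<close> from the middle outwards. A cell \<open>(j, i)\<close> with letter \<open>a\<close> replaces the current
  involution \<open>y\<close> by \<open>s y s\<close>, \<open>s = s\<^sub>a\<close>, in which case the transposed cell is also needed,
  or by \<open>y s = s y\<close>, when \<open>y\<close> fixes \<open>a\<close> and \<open>a + 1\<close>. The latter happens
  precisely when the pipes that cross at \<open>(j, i)\<close> meet again at \<open>(i, j)\<close>.\<close>

section \<open>Inversions and length\<close>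

text \<open>Length is given as a minimum over words and the Demazure product only by its axioms, so
  neither can be computed directly. The one-sided operators \<open>rmul\<close> and
  \<open>lmul\<close>, which multiply only at an ascent, commute with each other; hence the effect
  of a word on any \<open>v\<close> is determined by its effect on \<open>id\<close>. This gives
  existence and associativity without braid relations, and the axioms force the same values on every
  other solution.

  Minimality of involution words is awkward because an effective step lengthens the permutation by 1
  or by 2. Correcting the length by the number of moved points makes every effective step cost 4, so
  minimality becomes a numerical condition that passes to prefixes. This is what the lower
  triangular case needs: there the cells above the diagonal must be reconstructed, and whether a
  transposed cell is added is decided by the involution built from the earlier cells of
  \<open>D\<close> alone, so the construction is not circular.\<close>

declare One_nat_def [simp del]

definition invs :: "(nat \<Rightarrow> nat) \<Rightarrow> (nat \<times> nat) set" where
  "invs w = {(i, j). i < j \<and> w j < w i}"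

abbreviation len :: "(nat \<Rightarrow> nat) \<Rightarrow> nat" where
  "len w \<equiv> card (invs w)"

lemma word_prod_simps [simp]:
  "word_prod [] = id" "word_prod (a # as) = simple_refl a \<circ> word_prod as"
  by (simp_all add: word_prod_def)

lemma word_prod_append: "word_prod (as @ bs) = word_prod as \<circ> word_prod bs"
  by (induction as) (auto simp: o_assoc)

lemma simple_refl_invol [simp]: "simple_refl a (simple_refl a x) = x"
  by (simp add: simple_refl_def)

lemma simple_refl_comp_self [simp]: "simple_refl a \<circ> simple_refl a = id"
  by (simp add: fun_eq_iff)

lemma simple_refl_apply:
  "simple_refl a x = (if x = a then Suc a else if x = Suc a then a else x)"
  by (simp add: simple_refl_def transpose_def)

lemma simple_refl_in_Sym: "a \<in> {1..<n} \<Longrightarrow> simple_refl a \<in> Sym n"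
  unfolding Sym_def simple_refl_def by (simp add: permutes_swap_id)

lemma bij_simple_refl [simp]: "bij (simple_refl a)"
  by (simp add: simple_refl_def)

lemma inv_simple_refl [simp]: "inv (simple_refl a) = simple_refl a"
  by (simp add: simple_refl_def)

lemma bij_word_prod [simp]: "bij (word_prod as)"
proof (induction as)
  case (Cons a as)
  then show ?case unfolding word_prod_simps by (intro bij_comp bij_simple_refl)
qed (simp del: id_apply)

lemma Sym_id [simp]: "id \<in> Sym n"
  by (simp add: Sym_def permutes_id)

lemma Sym_comp: "v \<in> Sym n \<Longrightarrow> w \<in> Sym n \<Longrightarrow> v \<circ> w \<in> Sym n"
  by (simp add: Sym_def permutes_compose)

lemma Sym_inv: "w \<in> Sym n \<Longrightarrow> inv w \<in> Sym n"
  by (simp add: Sym_def permutes_inv)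

lemma Sym_bij: "w \<in> Sym n \<Longrightarrow> bij w"
  by (auto simp: Sym_def permutes_bij)

lemma word_prod_in_Sym: "set as \<subseteq> {1..<n} \<Longrightarrow> word_prod as \<in> Sym n"
  by (induction as) (auto intro!: Sym_comp simple_refl_in_Sym)

lemma invs_id [simp]: "invs id = {}"
  by (auto simp: invs_def)

lemma finite_invs: "w \<in> Sym n \<Longrightarrow> finite (invs w)"
proof -
  assume w: "w \<in> Sym n"
  have "invs w \<subseteq> {1..n} \<times> {1..n}"
  proof (clarify)
    fix i j assume "(i, j) \<in> invs w"
    then have ij: "i < j" "w j < w i" by (auto simp: invs_def)
    have out: "w x = x" if "x \<notin> {1..n}" for x using w that by (simp add: Sym_def permutes_not_in)
    have ins: "w x \<in> {1..n} \<longleftrightarrow> x \<in> {1..n}" for x using w unfolding Sym_def by (metis mem_Collect_eq permutes_in_image)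
    have j: "j \<in> {1..n}"
    proof (rule ccontr)
      assume "j \<notin> {1..n}"
      then have "w j = j" "n < j" using out[of j] ij(1) by auto
      then have "w i \<notin> {1..n}" using ij by auto
      then have "w i = i" using ins[of i] out[of i] by blast
      then show False using ij \<open>w j = j\<close> by simp
    qed
    moreover have "i \<noteq> 0"
    proof
      assume "i = 0"
      then show False using out[of 0] ij by simp
    qed
    ultimately show "i \<in> {1..n} \<and> j \<in> {1..n}" using ij(1) by simp
  qed
  then show ?thesis by (rule finite_subset) simp
qed

text \<open>No integer lies between \<open>a\<close> and \<open>Suc a\<close>, so exchanging them
  can reverse only this one pair. The length formulas, the commutation of the one-sided operators
  and the parity count for roots all rest on this.\<close>

lemma simple_refl_less_iff:
  assumes "{x, y} \<noteq> {a, Suc a}"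
  shows "simple_refl a x < simple_refl a y \<longleftrightarrow> x < y"
proof -
  have "\<not> (x = a \<and> y = Suc a)" "\<not> (x = Suc a \<and> y = a)" using assms by auto
  then show ?thesis unfolding simple_refl_apply by (simp split: if_split) linarith
qed

lemma invs_comp_simple_refl:
  assumes "w a < w (Suc a)"
  shows "invs (w \<circ> simple_refl a) = insert (a, Suc a) (map_prod (simple_refl a) (simple_refl a) ` invs w)"
proof (rule set_eqI, clarify)
  fix x y
  let ?s = "simple_refl a"
  have mem: "(x, y) \<in> map_prod ?s ?s ` invs w \<longleftrightarrow> (?s x, ?s y) \<in> invs w"
  proof
    assume "(?s x, ?s y) \<in> invs w"
    then have "map_prod ?s ?s (?s x, ?s y) \<in> map_prod ?s ?s ` invs w" by (rule imageI)
    then show "(x, y) \<in> map_prod ?s ?s ` invs w" by simp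
  qed auto
  show "(x, y) \<in> invs (w \<circ> ?s) \<longleftrightarrow> (x, y) \<in> insert (a, Suc a) (map_prod ?s ?s ` invs w)"
  proof (cases "{x, y} = {a, Suc a}")
    case True
    then consider "x = a" "y = Suc a" | "x = Suc a" "y = a" by (auto simp: doubleton_eq_iff)
    then show ?thesis
      unfolding insert_iff mem using assms by cases (simp_all add: invs_def simple_refl_apply)
  next
    case False
    then have "(x, y) \<noteq> (a, Suc a)" by auto
    then show ?thesis
      using simple_refl_less_iff[OF False] unfolding insert_iff mem by (auto simp: invs_def)
  qed
qed

lemma len_ascent:
  assumes "finite (invs w)" "w a < w (Suc a)"
  shows "len (w \<circ> simple_refl a) = Suc (len w)"
proof -
  let ?f = "map_prod (simple_refl a) (simple_refl a)"
  have "inj ?f" by (intro prod.inj_map bij_is_inj) auto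
  then have "card (?f ` invs w) = len w" by (meson card_image inj_on_subset subset_UNIV)
  moreover have "(a, Suc a) \<notin> ?f ` invs w"
  proof
    assume "(a, Suc a) \<in> ?f ` invs w"
    then obtain x y where xy: "(x, y) \<in> invs w" "a = simple_refl a x" "Suc a = simple_refl a y"
      by auto
    then have "x = simple_refl a a" "y = simple_refl a (Suc a)" by (metis simple_refl_invol)+
    then show False using xy(1) by (simp add: invs_def simple_refl_apply)
  qed
  ultimately show ?thesis using assms by (simp add: invs_comp_simple_refl)
qed

lemma len_descent:
  assumes "w \<in> Sym n" "a \<in> {1..<n}" "w (Suc a) < w a"
  shows "len w = Suc (len (w \<circ> simple_refl a))"
proof -
  have "w \<circ> simple_refl a \<in> Sym n" using assms by (simp add: Sym_comp simple_refl_in_Sym)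
  moreover have "(w \<circ> simple_refl a) a < (w \<circ> simple_refl a) (Suc a)"
    using assms(3) by (simp add: simple_refl_apply)
  ultimately have "len (w \<circ> simple_refl a \<circ> simple_refl a) = Suc (len (w \<circ> simple_refl a))"
    by (intro len_ascent finite_invs)
  then show ?thesis by (simp add: comp_assoc)
qed

lemma Sym_neq_Suc: "w \<in> Sym n \<Longrightarrow> w a \<noteq> w (Suc a)"
  by (metis Sym_bij bij_is_inj injD n_not_Suc_n)

lemma len_comp_simple_refl_le:
  assumes "w \<in> Sym n" "a \<in> {1..<n}"
  shows "len (w \<circ> simple_refl a) \<le> Suc (len w)"
  using len_ascent[OF finite_invs[OF assms(1)]] len_descent[OF assms] Sym_neq_Suc[OF assms(1)]
  by (metis Suc_leD Suc_leI less_Suc_eq_le linorder_neqE_nat order_refl lessI)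

text \<open>Positions and values change roles: an inversion \<open>(i, j)\<close> of
  \<open>w\<close> becomes the inversion \<open>(w j, w i)\<close> of \<open>inv w\<close>.\<close>

lemma len_inv: assumes "w \<in> Sym n" shows "len (inv w) = len w"
proof -
  have b: "bij w" using assms by (rule Sym_bij)
  then have "bij_betw (\<lambda>(i, j). (w j, w i)) (invs w) (invs (inv w))"
    by (intro bij_betwI[where g = "\<lambda>(i, j). (inv w j, inv w i)"])
      (auto simp: invs_def bij_is_inj bij_is_surj surj_f_inv_f)
  then show ?thesis using bij_betw_same_card by metis
qed

lemma len_simple_refl_comp_ascent:
  assumes "w \<in> Sym n" "a \<in> {1..<n}" "inv w a < inv w (Suc a)"
  shows "len (simple_refl a \<circ> w) = Suc (len w)"
proof -
  have "inv (simple_refl a \<circ> w) = inv w \<circ> simple_refl a"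
    using Sym_bij[OF assms(1)] by (simp add: o_inv_distrib)
  moreover have "simple_refl a \<circ> w \<in> Sym n" using assms by (simp add: Sym_comp simple_refl_in_Sym)
  ultimately show ?thesis
    using len_ascent[OF finite_invs[OF Sym_inv[OF assms(1)]] assms(3)] len_inv[of "simple_refl a \<circ> w" n]
      len_inv[OF assms(1)] by simp
qed

lemma ex_descent:
  assumes "w \<in> Sym n" "w \<noteq> id"
  shows "\<exists>a\<in>{1..<n}. w (Suc a) < w a"
proof (rule ccontr)
  assume "\<not> ?thesis"
  then have asc: "w a < w (Suc a)" if "a \<in> {1..<n}" for a
    using Sym_neq_Suc[OF assms(1), of a] that by (meson linorder_neqE_nat)
  have perm: "w permutes {1..n}" using assms by (simp add: Sym_def)
  have ge: "i \<le> n \<Longrightarrow> i \<le> w i" for i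
  proof (induction i)
    case (Suc i)
    show ?case
    proof (cases "i = 0")
      case True
      then show ?thesis using permutes_in_image[OF perm, of 1] Suc by (auto simp: One_nat_def)
    next
      case False
      then show ?thesis using asc[of i] Suc by auto
    qed
  qed simp
  have "w i = i" for i
  \<comment> \<open>Downwards from \<open>n\<close>: if \<open>w i > i\<close>, then
    \<open>w i\<close> is already known to be a fixed point, and \<open>w\<close> sends both
    \<open>i\<close> and \<open>w i\<close> to \<open>w i\<close>.\<close>
  proof (induction "n - i" arbitrary: i rule: less_induct)
    case less
    show ?case
    proof (rule ccontr)
      assume ne: "w i \<noteq> i"
      then have i: "i \<in> {1..n}" using permutes_not_in[OF perm] by blast
      then have "i < w i" "w i \<le> n" using ge[of i] ne permutes_in_image[OF perm, of i] by auto
      then have "w (w i) = w i" using i by (intro less) auto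
      then show False using ne permutes_inj[OF perm] by (meson injD)
    qed
  qed
  then show False using assms(2) by auto
qed

text \<open>From here on products are handled as functions and not evaluated at points; folds are
  unfolded only when applied to a state, never into compositions.\<close>

declare id_apply [simp del] o_apply [simp del] fold.simps [simp del] foldr.simps [simp del]
declare fold_simps [simp]

lemma foldr_simps' [simp]: "foldr f [] s = s" "foldr f (x # xs) s = f x (foldr f xs s)"
  by (simp_all add: foldr.simps o_apply id_apply)

lemma fold_append_apply [simp]: "fold f (xs @ ys) s = fold f ys (fold f xs s)"
  by (simp add: o_apply)

declare fold_append [simp del]

text \<open>Stripping a right descent lowers the number of inversions by one, and only the identity
  has no descent.\<close>

lemma ex_reduced_word:
  assumes "w \<in> Sym n"
  shows "\<exists>as. set as \<subseteq> {1..<n} \<and> word_prod as = w \<and> length as = len w"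
  using assms
proof (induction "len w" arbitrary: w rule: less_induct)
  case less
  show ?case
  proof (cases "w = id")
    case True
    then show ?thesis by (intro exI[of _ "[]"]) auto
  next
    case False
    then obtain a where a: "a \<in> {1..<n}" "w (Suc a) < w a" using ex_descent less by blast
    have l: "len w = Suc (len (w \<circ> simple_refl a))" by (rule len_descent[OF less(2) a])
    then obtain as where "set as \<subseteq> {1..<n}" "word_prod as = w \<circ> simple_refl a"
      "length as = len (w \<circ> simple_refl a)"
      using less a by (metis lessI Sym_comp simple_refl_in_Sym)
    then show ?thesis using a l
      by (intro exI[of _ "as @ [a]"]) (auto simp: word_prod_append comp_assoc)
  qed
qed

lemma len_word_prod_le:
  "set as \<subseteq> {1..<n} \<Longrightarrow> len (word_prod as) \<le> length as"
proof (induction as rule: rev_induct)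
  case (snoc a as)
  then show ?case
    using len_comp_simple_refl_le[OF word_prod_in_Sym, of as n a]
    by (simp add: word_prod_append)
qed simp

lemma cox_length_eq: "w \<in> Sym n \<Longrightarrow> cox_length n w = len w"
  unfolding cox_length_def
  by (rule Least_equality) (use ex_reduced_word len_word_prod_le in blast)+

section \<open>The Demazure product\<close>

text \<open>The right 0-Hecke action of a generator. It will turn out to be the Demazure product
  with \<open>simple_refl a\<close>, but is available before that product is known to exist.\<close>

definition rmul :: "nat \<Rightarrow> (nat \<Rightarrow> nat) \<Rightarrow> nat \<Rightarrow> nat" where
  "rmul a w = (if w a < w (Suc a) then w \<circ> simple_refl a else w)"

definition lmul :: "nat \<Rightarrow> (nat \<Rightarrow> nat) \<Rightarrow> nat \<Rightarrow> nat" where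
  "lmul a w = (if inv w a < inv w (Suc a) then simple_refl a \<circ> w else w)"

abbreviation rmuls :: "nat list \<Rightarrow> (nat \<Rightarrow> nat) \<Rightarrow> nat \<Rightarrow> nat" where
  "rmuls \<equiv> fold rmul"

abbreviation lmuls :: "nat list \<Rightarrow> (nat \<Rightarrow> nat) \<Rightarrow> nat \<Rightarrow> nat" where
  "lmuls \<equiv> foldr lmul"

lemma rmul_id [simp]: "rmul a id = simple_refl a"
  by (simp add: rmul_def id_apply)

lemma rmul_ascent: "w a < w (Suc a) \<Longrightarrow> rmul a w = w \<circ> simple_refl a"
  by (simp add: rmul_def)

lemma rmul_descent: "\<not> w a < w (Suc a) \<Longrightarrow> rmul a w = w"
  by (simp add: rmul_def)

lemma bij_rmul: "bij w \<Longrightarrow> bij (rmul a w)"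
  by (auto simp: rmul_def intro: bij_comp)

lemma rmul_in_Sym: "w \<in> Sym n \<Longrightarrow> a \<in> {1..<n} \<Longrightarrow> rmul a w \<in> Sym n"
  by (auto simp: rmul_def intro!: Sym_comp simple_refl_in_Sym)

lemma rmuls_in_Sym: "w \<in> Sym n \<Longrightarrow> set as \<subseteq> {1..<n} \<Longrightarrow> rmuls as w \<in> Sym n"
  by (induction as arbitrary: w) (auto simp: rmul_in_Sym)

text \<open>The right operator compares the values at positions \<open>a\<close>,
  \<open>Suc a\<close>, the left one the positions of the values \<open>b\<close>,
  \<open>Suc b\<close>. Each leaves the other's comparison unchanged unless these positions carry
  exactly these values.\<close>

lemma rmul_lmul:
  assumes "bij w"
  shows "rmul a (lmul b w) = lmul b (rmul a w)"
proof -
  let ?s = "simple_refl a" and ?t = "simple_refl b"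
  have inv1: "inv (w \<circ> ?s) = ?s \<circ> inv w" using assms by (simp add: o_inv_distrib)
  have eq: "inv w y = x \<longleftrightarrow> w x = y" for x y
    using assms by (metis bij_inv_eq_iff)
  show ?thesis
  proof (cases "{w a, w (Suc a)} = {b, Suc b}")
    \<comment> \<open>The interfering case: on an ascent both multiplications give the same
      permutation and whichever comes second is absorbed; on a descent neither acts.\<close>
    case True
    then consider "w a = b" "w (Suc a) = Suc b" | "w a = Suc b" "w (Suc a) = b"
      by (auto simp: doubleton_eq_iff)
    then show ?thesis
    proof cases
      case 1
      then have "inv w b = a" "inv w (Suc b) = Suc a" by (auto simp: eq)
      moreover have "?t \<circ> w = w \<circ> ?s"
      proof
        fix x show "(?t \<circ> w) x = (w \<circ> ?s) x"
          using 1 inj_eq[OF bij_is_inj[OF assms], of x a] inj_eq[OF bij_is_inj[OF assms], of x "Suc a"]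
          by (auto simp: simple_refl_apply o_apply)
      qed
      ultimately show ?thesis using 1 by (simp add: rmul_def lmul_def inv1 simple_refl_apply o_apply)
    next
      case 2
      then have "inv w b = Suc a" "inv w (Suc b) = a" by (auto simp: eq)
      then show ?thesis using 2 by (simp add: rmul_def lmul_def)
    qed
  next
    case False
    then have 1: "?t (w a) < ?t (w (Suc a)) \<longleftrightarrow> w a < w (Suc a)"
      by (rule simple_refl_less_iff)
    have "{inv w b, inv w (Suc b)} \<noteq> {a, Suc a}"
      using False by (auto simp: doubleton_eq_iff eq)
    then have "?s (inv w b) < ?s (inv w (Suc b)) \<longleftrightarrow> inv w b < inv w (Suc b)"
      by (rule simple_refl_less_iff)
    then show ?thesis using 1 by (simp add: rmul_def lmul_def inv1 comp_assoc o_apply)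
  qed
qed

lemma rmuls_lmul: "bij w \<Longrightarrow> rmuls as (lmul b w) = lmul b (rmuls as w)"
  by (induction as arbitrary: w) (auto simp: rmul_lmul bij_rmul)

lemma bij_lmuls: "bij w \<Longrightarrow> bij (lmuls as w)"
  by (induction as) (auto simp: lmul_def intro: bij_comp)

lemma rmuls_lmuls: "bij w \<Longrightarrow> rmuls as (lmuls bs w) = lmuls bs (rmuls as w)"
  by (induction bs) (auto simp: rmuls_lmul bij_lmuls)

lemma lmul_id [simp]: "lmul a id = simple_refl a"
  by (simp add: lmul_def id_apply)

lemma lmuls_id: "lmuls as id = rmuls as id"
  by (induction as) (auto simp: rmuls_lmul[symmetric] simp flip: lmul_id)

lemma rmuls_reduced:
  assumes "set as \<subseteq> {1..<n}" "len (word_prod as) = length as"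
  shows "rmuls as id = word_prod as"
  using assms
proof (induction as rule: rev_induct)
  case (snoc a as)
  let ?w = "word_prod as"
  have w: "?w \<in> Sym n" using snoc by (auto intro!: word_prod_in_Sym)
  have l: "len ?w \<le> length as" using snoc by (auto intro!: len_word_prod_le[of _ n])
  have "len (?w \<circ> simple_refl a) = Suc (length as)" using snoc by (simp add: word_prod_append)
  then have "len ?w = length as" "\<not> ?w (Suc a) < ?w a"
    using l len_comp_simple_refl_le[OF w, of a] len_descent[OF w, of a] snoc(2) by auto
  then show ?case using snoc Sym_neq_Suc[OF w, of a] by (simp add: rmul_ascent word_prod_append)
qed simp

lemma ex_rmuls:
  assumes "w \<in> Sym n"
  shows "\<exists>as. set as \<subseteq> {1..<n} \<and> word_prod as = w \<and> length as = len w \<and> rmuls as id = w"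
proof -
  obtain as where "set as \<subseteq> {1..<n}" "word_prod as = w" "length as = len w"
    using ex_reduced_word[OF assms] by blast
  then show ?thesis using rmuls_reduced[of as n] by (intro exI[of _ as]) simp
qed

lemma len_rmuls_le:
  assumes "w \<in> Sym n" "set as \<subseteq> {1..<n}"
  shows "len (rmuls as w) \<le> len w + length as"
  using assms
proof (induction as arbitrary: w)
  case (Cons a as)
  have "len (rmul a w) \<le> Suc (len w)"
    using len_ascent[OF finite_invs[OF Cons(2)]] by (auto simp: rmul_def)
  then show ?case using Cons rmul_in_Sym[of w n a] by fastforce
qed simp

text \<open>Write \<open>v\<close> as a left word applied to \<open>id\<close> and move that word
  outside by commutation. This replaces the argument that any two reduced words are linked by braid
  moves.\<close>

lemma rmuls_cong:
  assumes "rmuls as id = rmuls bs id" "v \<in> Sym n"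
  shows "rmuls as v = rmuls bs v"
proof -
  obtain cs where "lmuls cs id = v" using ex_rmuls[OF assms(2)] lmuls_id by metis
  then show ?thesis using rmuls_lmuls[of id] assms(1) by (metis bij_id)
qed

section \<open>Existence of the Demazure product\<close>

definition hecke :: "nat \<Rightarrow> (nat \<Rightarrow> nat) \<Rightarrow> (nat \<Rightarrow> nat) \<Rightarrow> nat \<Rightarrow> nat" where
  "hecke n v w = rmuls (SOME as. set as \<subseteq> {1..<n} \<and> rmuls as id = w) v"

text \<open>The chosen word is irrelevant, and the word used instead may be any word with the right
  Demazure value, reduced or not.\<close>

lemma hecke_rmuls:
  assumes "v \<in> Sym n" "set as \<subseteq> {1..<n}"
  shows "hecke n v (rmuls as id) = rmuls as v"
proof -
  let ?P = "\<lambda>bs. set bs \<subseteq> {1..<n} \<and> rmuls bs id = rmuls as id"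
  have "?P (SOME bs. ?P bs)" by (rule someI[of ?P as]) (use assms in auto)
  then show ?thesis unfolding hecke_def using rmuls_cong[OF _ assms(1)] by blast
qed

lemma is_demazure_product_hecke: "is_demazure_product n (hecke n)"
  unfolding is_demazure_product_def
proof (intro conjI ballI impI)
  fix v w assume v: "v \<in> Sym n" and w: "w \<in> Sym n"
  obtain bs where bs: "set bs \<subseteq> {1..<n}" "word_prod bs = w" "length bs = len w" "rmuls bs id = w"
    using ex_rmuls[OF w] by blast
  obtain as where as: "set as \<subseteq> {1..<n}" "word_prod as = v" "length as = len v" "rmuls as id = v"
    using ex_rmuls[OF v] by blast
  show "hecke n v w \<in> Sym n" using hecke_rmuls[OF v bs(1)] bs v by (simp add: rmuls_in_Sym)
  {
    fix u assume u: "u \<in> Sym n"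
    \<comment> \<open>The concatenated word represents the product, so associativity reduces to that
      of appending lists.\<close>
    have "hecke n v w = rmuls (as @ bs) id" using hecke_rmuls[OF v bs(1)] bs as by simp
    then have "hecke n u (hecke n v w) = rmuls (as @ bs) u"
      using hecke_rmuls[OF u, of "as @ bs"] as bs by simp
    moreover have "hecke n u v = rmuls as u" using hecke_rmuls[OF u as(1)] as by simp
    moreover have "hecke n (rmuls as u) w = rmuls bs (rmuls as u)"
      using hecke_rmuls[of "rmuls as u" n bs] rmuls_in_Sym[OF u as(1)] bs by simp
    ultimately show "hecke n (hecke n u v) w = hecke n u (hecke n v w)" by simp
  }
  assume "cox_length n (v \<circ> w) = cox_length n v + cox_length n w"
  \<comment> \<open>Additivity of lengths says exactly that the concatenation of the two reduced
    words is reduced.\<close>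
  then have "len (word_prod (as @ bs)) = length (as @ bs)"
    using as bs v w by (simp add: cox_length_eq Sym_comp word_prod_append)
  then have "rmuls (as @ bs) id = word_prod (as @ bs)"
    using as bs by (intro rmuls_reduced[of _ n]) auto
  then show "hecke n v w = v \<circ> w"
    using hecke_rmuls[OF v bs(1)] as bs by (simp add: word_prod_append)
next
  fix i assume i: "i \<in> {1..<n}"
  show "hecke n (simple_refl i) (simple_refl i) = simple_refl i"
    using hecke_rmuls[OF simple_refl_in_Sym[OF i], of "[i]"] i
    by (simp add: rmul_descent simple_refl_apply)
qed

section \<open>Uniqueness of the Demazure product\<close>

lemma len_simple_refl: "len (simple_refl a) = 1"
  using len_ascent[of id a] by (simp add: id_apply)

text \<open>At an ascent the length axiom applies. At a descent it gives \<open>v\<close> as the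
  product of \<open>v \<circ> ?s\<close> and \<open>?s\<close>, and associativity with idempotence
  absorbs the second \<open>?s\<close>.\<close>

lemma demazure_product_simple_refl:
  assumes f: "is_demazure_product n f" and v: "v \<in> Sym n" and a: "a \<in> {1..<n}"
  shows "f v (simple_refl a) = rmul a v"
proof -
  let ?s = "simple_refl a"
  have s: "?s \<in> Sym n" using a by (rule simple_refl_in_Sym)
  have mult: "f u ?s = u \<circ> ?s" if "u \<in> Sym n" "len (u \<circ> ?s) = Suc (len u)" for u
    using f that s by (simp add: is_demazure_product_def cox_length_eq Sym_comp len_simple_refl)
  show ?thesis
  proof (cases "v a < v (Suc a)")
    case True
    then show ?thesis using mult[OF v] len_ascent[OF finite_invs[OF v]] by (simp add: rmul_def)
  next
    case False
    then have "len v = Suc (len (v \<circ> ?s))" using v a Sym_neq_Suc[OF v, of a] by (auto intro!: len_descent)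
    then have "f (v \<circ> ?s) ?s = v" using mult[of "v \<circ> ?s"] v s by (simp add: Sym_comp comp_assoc)
    moreover have "f (f (v \<circ> ?s) ?s) ?s = f (v \<circ> ?s) (f ?s ?s)" "f ?s ?s = ?s"
      using f v s a by (auto simp: is_demazure_product_def Sym_comp)
    ultimately show ?thesis using False by (simp add: rmul_def)
  qed
qed

lemma demazure_product_rmuls:
  assumes f: "is_demazure_product n f" and v: "v \<in> Sym n"
    and "set as \<subseteq> {1..<n}" "len (word_prod as) = length as"
  shows "f v (word_prod as) = rmuls as v"
  using assms(3-)
proof (induction as rule: rev_induct)
  case Nil
  \<comment> \<open>No axiom names a unit; that \<open>id\<close> is one on the right comes from the
    length axiom.\<close>
  have "\<forall>w\<in>Sym n. cox_length n (v \<circ> w) = cox_length n v + cox_length n w \<longrightarrow> f v w = v \<circ> w"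
    using f v unfolding is_demazure_product_def by blast
  from bspec[OF this Sym_id] show ?case using v by (simp add: cox_length_eq)
next
  case (snoc a as)
  let ?w = "word_prod as" and ?s = "simple_refl a"
  have w: "?w \<in> Sym n" using snoc by (auto intro!: word_prod_in_Sym)
  have l: "len ?w \<le> length as" using snoc by (auto intro!: len_word_prod_le[of _ n])
  have "len (?w \<circ> ?s) = Suc (length as)" using snoc by (simp add: word_prod_append)
  then have lw: "len ?w = length as" "\<not> ?w (Suc a) < ?w a"
    using l len_comp_simple_refl_le[OF w, of a] len_descent[OF w, of a] snoc(2) by auto
  then have "?w \<circ> ?s = rmul a ?w" using Sym_neq_Suc[OF w, of a] by (simp add: rmul_def)
  also have "\<dots> = f ?w ?s" using demazure_product_simple_refl[OF f w] snoc by simp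
  finally have "f v (?w \<circ> ?s) = f (f v ?w) ?s"
    using f v w snoc(2) by (simp add: is_demazure_product_def simple_refl_in_Sym)
  also have "\<dots> = rmul a (rmuls as v)"
    using snoc lw demazure_product_simple_refl[OF f, of "rmuls as v" a] rmuls_in_Sym[OF v] by simp
  finally show ?case by (simp add: word_prod_append)
qed

lemma demazure_eq_hecke:
  assumes "v \<in> Sym n" "w \<in> Sym n"
  shows "demazure n v w = hecke n v w"
  unfolding demazure_def
proof (rule the_equality)
  show "\<exists>f. is_demazure_product n f \<and> f v w = hecke n v w"
    using is_demazure_product_hecke by blast
next
  fix u assume "\<exists>f. is_demazure_product n f \<and> f v w = u"
  then obtain f where f: "is_demazure_product n f" "f v w = u" by blast
  obtain as where "set as \<subseteq> {1..<n}" "word_prod as = w" "length as = len w"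
    using ex_reduced_word[OF assms(2)] by blast
  then show "u = hecke n v w"
    using f demazure_product_rmuls[OF f(1) assms(1), of as]
      demazure_product_rmuls[OF is_demazure_product_hecke assms(1), of as] by simp
qed

lemma demazure_rmuls:
  "v \<in> Sym n \<Longrightarrow> set as \<subseteq> {1..<n} \<Longrightarrow> demazure n v (rmuls as id) = rmuls as v"
  by (simp add: demazure_eq_hecke rmuls_in_Sym hecke_rmuls)

lemma demazure_simple_refl_right:
  "v \<in> Sym n \<Longrightarrow> a \<in> {1..<n} \<Longrightarrow> demazure n v (simple_refl a) = rmul a v"
  using demazure_rmuls[of v n "[a]"] by simp

lemma demazure_simple_refl_left:
  assumes "v \<in> Sym n" "a \<in> {1..<n}"
  shows "demazure n (simple_refl a) v = lmul a v"
proof -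
  obtain as where as: "set as \<subseteq> {1..<n}" "rmuls as id = v" using ex_rmuls[OF assms(1)] by blast
  have "demazure n (simple_refl a) v = rmuls as (simple_refl a)"
    using demazure_rmuls[OF simple_refl_in_Sym[OF assms(2)] as(1)] as by simp
  also have "\<dots> = lmul a v" using rmuls_lmul[of id as a] as by simp
  finally show ?thesis .
qed

section \<open>Involution words and atoms\<close>

definition istep :: "nat \<Rightarrow> (nat \<Rightarrow> nat) \<Rightarrow> nat \<Rightarrow> nat" where
  "istep a y = rmul a (lmul a y)"

lemma lmul_in_Sym: "w \<in> Sym n \<Longrightarrow> a \<in> {1..<n} \<Longrightarrow> lmul a w \<in> Sym n"
  by (auto simp: lmul_def intro!: Sym_comp simple_refl_in_Sym)

lemma istep_in_Sym: "w \<in> Sym n \<Longrightarrow> a \<in> {1..<n} \<Longrightarrow> istep a w \<in> Sym n"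
  by (simp add: istep_def rmul_in_Sym lmul_in_Sym)

lemma isteps_in_Sym: "w \<in> Sym n \<Longrightarrow> set as \<subseteq> {1..<n} \<Longrightarrow> fold istep as w \<in> Sym n"
  by (induction as arbitrary: w) (auto simp: istep_in_Sym)

lemma demazure_conj_eq: "set as \<subseteq> {1..<n} \<Longrightarrow> demazure_conj n as = fold istep as id"
proof (induction as rule: rev_induct)
  case (snoc a as)
  then have y: "fold istep as id \<in> Sym n" and a: "a \<in> {1..<n}" by (auto intro!: isteps_in_Sym)
  have "demazure_conj n (as @ [a]) =
      demazure n (demazure n (simple_refl a) (fold istep as id)) (simple_refl a)"
    using snoc by (simp add: demazure_conj_def)
  then show ?case
    using demazure_simple_refl_left[OF y a] demazure_simple_refl_right[OF lmul_in_Sym[OF y a] a]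
      istep_def[of a "fold istep as id"] by simp
qed (simp add: demazure_conj_def)

lemma inv_rmul: "bij w \<Longrightarrow> inv (rmul a w) = lmul a (inv w)"
  by (simp add: rmul_def lmul_def o_inv_distrib inv_inv_eq)

lemma inv_rmuls: "bij w \<Longrightarrow> inv (rmuls as w) = lmuls (rev as) (inv w)"
  by (induction as arbitrary: w) (auto simp: inv_rmul bij_rmul)

text \<open>The word of \<open>inv w\<close> acts from the left and that of \<open>w\<close> from
  the right. Since the two actions commute, their letters can be interleaved from the middle
  outwards. Reducedness is not assumed, so arbitrary competitors of an involution word are covered
  too.\<close>

lemma demazure_inv_rmuls:
  assumes "set as \<subseteq> {1..<n}"
  shows "demazure n (inv (rmuls as id)) (rmuls as id) = demazure_conj n as"
proof -
  have "demazure n (inv (rmuls as id)) (rmuls as id) = rmuls as (lmuls (rev as) id)"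
    using demazure_rmuls[OF Sym_inv[OF rmuls_in_Sym[OF Sym_id assms]] assms] inv_rmuls[of id as] by simp
  also have "\<dots> = fold istep as id"
  proof (induction as rule: rev_induct)
    case (snoc a as)
    have "rmuls (as @ [a]) (lmuls (rev (as @ [a])) id)
      = rmul a (lmul a (rmuls as (lmuls (rev as) id)))"
      by (simp add: rmuls_lmul bij_lmuls)
    then show ?case using snoc by (simp add: istep_def)
  qed simp
  finally show ?thesis using assms by (simp add: demazure_conj_eq)
qed

text \<open>The Demazure value of a word is never longer than the word, and every \<open>v\<close>
  has a word of length \<open>len v\<close>; so the two minimization problems have the same
  minimum.\<close>

lemma involution_word_iff_atom:
  "involution_word n z as \<longleftrightarrow>
    set as \<subseteq> {1..<n} \<and> len (word_prod as) = length as \<and> atom n z (word_prod as)"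
proof
  assume iw: "involution_word n z as"
  then have as: "set as \<subseteq> {1..<n}" and z: "z = demazure_conj n as"
    and min: "\<And>bs. set bs \<subseteq> {1..<n} \<Longrightarrow> z = demazure_conj n bs \<Longrightarrow> length as \<le> length bs"
    by (auto simp: involution_word_def)
  have min': "length as \<le> len v" if v: "v \<in> Sym n" "z = demazure n (inv v) v" for v
  proof -
    obtain bs where "set bs \<subseteq> {1..<n}" "length bs = len v" "rmuls bs id = v"
      using ex_rmuls[OF v(1)] by blast
    then show ?thesis using min demazure_inv_rmuls v(2) by metis
  qed
  let ?w = "rmuls as id"
  have w: "?w \<in> Sym n" using as by (simp add: rmuls_in_Sym)
  have zw: "z = demazure n (inv ?w) ?w" using demazure_inv_rmuls as z by simp
  have lw: "length as = len ?w"
    using min'[OF w zw] len_rmuls_le[of id n as] as by simp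
  have "len (word_prod as) = length as" "word_prod as = ?w"
  proof -
    \<comment> \<open>If the length of the Demazure value equals that of the word, no letter was
      absorbed, and Demazure and ordinary products agree.\<close>
    have "rmuls bs id = word_prod bs" if "set bs \<subseteq> {1..<n}" "len (rmuls bs id) = length bs" for bs
      using that
    proof (induction bs rule: rev_induct)
      case (snoc b bs)
      have v: "rmuls bs id \<in> Sym n" using snoc by (simp add: rmuls_in_Sym)
      have "len (rmuls bs id) \<le> length bs" using len_rmuls_le[of id n bs] snoc by simp
      moreover have "len (rmul b (rmuls bs id)) = Suc (length bs)" using snoc by simp
      ultimately have "rmul b (rmuls bs id) \<noteq> rmuls bs id" by auto
      then have asc: "rmuls bs id b < rmuls bs id (Suc b)" by (auto simp: rmul_def)
      then have "len (rmuls bs id) = length bs"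
        using snoc(3) len_ascent[OF finite_invs[OF v], of b] by (simp add: rmul_ascent)
      then show ?case using asc snoc by (simp add: rmul_ascent word_prod_append)
    qed simp
    then show "word_prod as = ?w" using as lw by simp
    then show "len (word_prod as) = length as" using lw by simp
  qed
  then show "set as \<subseteq> {1..<n} \<and> len (word_prod as) = length as \<and> atom n z (word_prod as)"
    using as w zw min' lw by (simp add: atom_def cox_length_eq)
next
  assume "set as \<subseteq> {1..<n} \<and> len (word_prod as) = length as \<and> atom n z (word_prod as)"
  then have as: "set as \<subseteq> {1..<n}" and l: "len (word_prod as) = length as"
    and at: "atom n z (word_prod as)" by auto
  have r: "word_prod as = rmuls as id" using rmuls_reduced as l by simp
  have "length as \<le> length bs" if bs: "set bs \<subseteq> {1..<n}" "z = demazure_conj n bs" for bs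
  proof -
    have v: "rmuls bs id \<in> Sym n" using bs by (simp add: rmuls_in_Sym)
    then have "len (word_prod as) \<le> len (rmuls bs id)"
      using at bs demazure_inv_rmuls[OF bs(1)] by (auto simp: atom_def cox_length_eq)
    then show ?thesis using l len_rmuls_le[of id n bs] bs by simp
  qed
  moreover have "z = demazure_conj n as"
    using at r demazure_inv_rmuls[OF as] by (simp add: atom_def)
  ultimately show "involution_word n z as" using as by (simp add: involution_word_def)
qed

section \<open>Words and their inversions\<close>

text \<open>For each letter, the unordered pair of points whose current values it exchanges, read
  off the suffix after it. For a reading word these are the two pipes crossing in the corresponding
  cell.\<close>

fun roots :: "nat list \<Rightarrow> nat set list" where
  "roots [] = []"
| "roots (a # as) = {inv (word_prod as) a, inv (word_prod as) (Suc a)} # roots as"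

lemma length_roots [simp]: "length (roots as) = length as"
  by (induction as) auto

lemma simple_refl_less_swap:
  assumes "{x, y} = {a, Suc a}"
  shows "simple_refl a x < simple_refl a y \<longleftrightarrow> y < x"
  using assms by (auto simp: simple_refl_apply doubleton_eq_iff)

lemma inv_pair_eq_iff:
  assumes "bij w"
  shows "{inv w a, inv w b} = {p, q} \<longleftrightarrow> {w p, w q} = {a, b}"
proof -
  have "inv w y = x \<longleftrightarrow> w x = y" for x y
    using assms by (metis bij_inv_eq_iff)
  then show ?thesis by (auto simp: doubleton_eq_iff)
qed

text \<open>A letter reverses the relative order of the images of \<open>p\<close> and
  \<open>q\<close> exactly when its root is \<open>{p, q}\<close>.\<close>

lemma inverted_iff_odd_count:
  assumes "p < q"
  shows "word_prod as q < word_prod as p \<longleftrightarrow> odd (count_list (roots as) {p, q})"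
proof (induction as)
  case Nil
  show ?case using assms by (simp add: id_apply)
next
  case (Cons a as)
  let ?w = "word_prod as"
  have "?w p \<noteq> ?w q" using assms bij_is_inj[OF bij_word_prod, of as] by (metis injD nat_neq_iff)
  then show ?case
    using Cons simple_refl_less_iff[of "?w q" "?w p" a] simple_refl_less_swap[of "?w q" "?w p" a]
      inv_pair_eq_iff[OF bij_word_prod, of as a "Suc a" p q]
    by (cases "{?w p, ?w q} = {a, Suc a}") (auto simp: o_apply insert_commute)
qed

lemma roots_elem:
  assumes "P \<in> set (roots as)" "set as \<subseteq> {1..<n}"
  shows "\<exists>p q. p < q \<and> p \<in> {1..n} \<and> q \<in> {1..n} \<and> P = {p, q}"
  using assms
proof (induction as)
  case (Cons a as)
  show ?case
  proof (cases "P \<in> set (roots as)")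
    case True
    then show ?thesis using Cons by simp
  next
    case False
    let ?u = "inv (word_prod as)"
    have as: "set as \<subseteq> {1..<n}" "a \<in> {1..<n}" using Cons.prems by auto
    have u: "?u \<in> Sym n" by (intro Sym_inv word_prod_in_Sym as)
    then have "?u a \<in> {1..n}" "?u (Suc a) \<in> {1..n}" 
      using as(2) permutes_in_image[of ?u "{1..n}"] by (auto simp: Sym_def)
    moreover have "?u a \<noteq> ?u (Suc a)" using u by (rule Sym_neq_Suc)
    moreover have "P = {?u a, ?u (Suc a)}" using False Cons.prems by simp
    ultimately show ?thesis by (metis insert_commute linorder_neqE_nat)
  qed
qed simp

lemma distinct_iff_count_list_le_1: "distinct xs \<longleftrightarrow> (\<forall>x. count_list xs x \<le> 1)"
proof
  show "distinct xs \<Longrightarrow> \<forall>x. count_list xs x \<le> 1"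
    by (induction xs) simp_all
next
  show "\<forall>x. count_list xs x \<le> 1 \<Longrightarrow> distinct xs"
  proof (induction xs)
    case (Cons x xs)
    have "count_list xs y \<le> 1" for y
      using spec[OF Cons.prems, of y] by (simp split: if_splits)
    moreover have "count_list xs x = 0" using spec[OF Cons.prems, of x] by simp
    ultimately show ?case using Cons.IH by (simp add: count_list_0_iff)
  qed simp
qed

text \<open>Elements of odd multiplicity are among the members of the list, and the number of
  distinct members reaches the length only without repetition.\<close>

lemma card_odd_count_eq_length_iff:
  "card {x. odd (count_list xs x)} = length xs \<longleftrightarrow> distinct xs"
proof
  have sub: "{x. odd (count_list xs x)} \<subseteq> set xs"
    by (metis (mono_tags, lifting) count_list_0_iff even_zero mem_Collect_eq subsetI)
  {
    assume "card {x. odd (count_list xs x)} = length xs"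
    then have "length xs \<le> card (set xs)" using card_mono[OF _ sub] by simp
    then show "distinct xs" using card_length[of xs] by (intro card_distinct) simp
  next
    assume d: "distinct xs"
    then have "{x. odd (count_list xs x)} = set xs"
    proof (intro equalityI sub subsetI CollectI)
      fix x assume "x \<in> set xs"
      then have "count_list xs x = 1"
        using d by (metis count_list_0_iff distinct_iff_count_list_le_1 le_antisym less_one linorder_not_le)
      then show "odd (count_list xs x)" by simp
    qed
    then show "card {x. odd (count_list xs x)} = length xs" using d by (simp add: distinct_card)
  }
qed

text \<open>Inversions are the roots of odd multiplicity, so a word is reduced when no root repeats.
  This is the form in which the condition that pipes cross at most once appears.\<close>

lemma len_eq_length_iff_distinct:
  assumes "set as \<subseteq> {1..<n}"
  shows "len (word_prod as) = length as \<longleftrightarrow> distinct (roots as)"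
proof -
  have "bij_betw (\<lambda>(p, q). {p, q}) (invs (word_prod as)) {P. odd (count_list (roots as) P)}"
  proof (rule bij_betwI')
    fix x y assume "x \<in> invs (word_prod as)" "y \<in> invs (word_prod as)"
    then show "((case x of (p, q) \<Rightarrow> {p, q}) = (case y of (p, q) \<Rightarrow> {p, q})) = (x = y)"
      by (auto simp: invs_def doubleton_eq_iff)
  next
    fix x assume "x \<in> invs (word_prod as)"
    then show "(case x of (p, q) \<Rightarrow> {p, q}) \<in> {P. odd (count_list (roots as) P)}"
      by (auto simp: invs_def inverted_iff_odd_count)
  next
    fix P assume P: "P \<in> {P. odd (count_list (roots as) P)}"
    then have "count_list (roots as) P \<noteq> 0" by (metis even_zero mem_Collect_eq)
    then have "P \<in> set (roots as)" by (simp add: count_list_0_iff)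
    from roots_elem[OF this assms] obtain p q where "p < q" "P = {p, q}" by blast
    then show "\<exists>x\<in>invs (word_prod as). P = (case x of (p, q) \<Rightarrow> {p, q})"
      using P by (intro bexI[of _ "(p, q)"]) (auto simp: invs_def inverted_iff_odd_count)
  qed
  then show ?thesis
    using card_odd_count_eq_length_iff[of "roots as"] by (simp add: bij_betw_same_card)
qed

section \<open>Pipes and reading words\<close>

definition stair :: "nat \<Rightarrow> (nat \<times> nat) set" where
  "stair n = {(i, j) \<in> grid n. i + j \<le> n}"

definition letter :: "nat \<times> nat \<Rightarrow> nat" where
  "letter c = fst c + snd c - 1"

definition cells_word :: "(nat \<times> nat) set \<Rightarrow> (nat \<times> nat) list \<Rightarrow> nat list" where
  "cells_word D cs = map letter (filter (\<lambda>c. c \<in> D) cs)"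

lemma cells_word_simps [simp]:
  "cells_word D [] = []"
  "cells_word D (c # cs) = (if c \<in> D then letter c # cells_word D cs else cells_word D cs)"
  "cells_word D (xs @ ys) = cells_word D xs @ cells_word D ys"
  by (simp_all add: cells_word_def)

text \<open>A listing is a reading order given as the list of all cells.\<close>

definition listing :: "nat \<Rightarrow> (nat \<times> nat) list \<Rightarrow> bool" where
  "listing n cs \<longleftrightarrow> distinct cs \<and> set cs = grid n \<and> sorted_wrt (\<lambda>s t. \<not> le_NE t s) cs"

text \<open>The letter \<open>i + j - 1\<close> is below \<open>n\<close> just when the cell lies in
  the staircase. Admissible letters in a word over the whole grid therefore recover the support
  condition on a pipe dream.\<close>

lemma set_cells_word_subset:
  assumes "D \<subseteq> grid n" "set cs \<subseteq> grid n"
  shows "D \<subseteq> stair n \<Longrightarrow> set (cells_word D cs) \<subseteq> {1..<n}"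
    and "grid n \<subseteq> set cs \<Longrightarrow> set (cells_word D cs) \<subseteq> {1..<n} \<Longrightarrow> D \<subseteq> stair n"
proof -
  assume "D \<subseteq> stair n"
  then show "set (cells_word D cs) \<subseteq> {1..<n}"
    by (fastforce simp: cells_word_def letter_def stair_def grid_def)
next
  assume a: "grid n \<subseteq> set cs" "set (cells_word D cs) \<subseteq> {1..<n}"
  show "D \<subseteq> stair n"
  proof
    fix c assume c: "c \<in> D"
    then have "letter c \<in> set (cells_word D cs)" using a assms by (auto simp: cells_word_def)
    then have "letter c < n" using a by auto
    then show "c \<in> stair n" using c assms by (cases c) (auto simp: stair_def letter_def grid_def)
  qed
qed

section \<open>Tracing pipes backwards\<close>

lemma wire_to_LeftEdge:
  "wire n D e (LeftEdge i (Suc j)) \<longleftrightarrow>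
    (i, j) \<in> stair n \<and> e = (if (i, j) \<in> D then LeftEdge i j else TopEdge (Suc i) j)"
  by (auto simp: wire.simps stair_def)

lemma wire_to_TopEdge:
  "wire n D e (TopEdge i j) \<longleftrightarrow>
    (i, j) \<in> grid n \<and> i + j \<le> n + 1 \<and>
    e = (if i + j \<le> n \<and> (i, j) \<in> D then TopEdge (Suc i) j else LeftEdge i j)"
  by (auto simp: wire.simps)

lemma no_wire_to_LeftEdge_1: "\<not> wire n D e (LeftEdge i 1)"
  by (auto simp: wire.simps grid_def)

text \<open>An edge with a unique incoming path lies on a pipe just when its predecessor does; only
  the starting edge of the pipe needs no predecessor.\<close>

lemma pipe_wire:
  assumes "\<And>e'. wire n D e' e \<longleftrightarrow> e' = e0" "e \<noteq> LeftEdge k 1"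
  shows "e \<in> pipe n D k \<longleftrightarrow> e0 \<in> pipe n D k"
proof
  assume "e \<in> pipe n D k"
  then show "e0 \<in> pipe n D k"
    unfolding pipe_def using assms by (auto elim: rtranclp.cases)
next
  assume "e0 \<in> pipe n D k"
  then show "e \<in> pipe n D k"
    unfolding pipe_def using assms by (auto intro: rtranclp.rtrancl_into_rtrancl)
qed

lemma LeftEdge_1_in_pipe: "LeftEdge i 1 \<in> pipe n D k \<longleftrightarrow> i = k"
  unfolding pipe_def using no_wire_to_LeftEdge_1 by (auto elim: rtranclp.cases)

lemma LeftEdge_in_pipe:
  "(i, j) \<in> stair n \<Longrightarrow> LeftEdge i (Suc j) \<in> pipe n D k \<longleftrightarrow>
    (if (i, j) \<in> D then LeftEdge i j else TopEdge (Suc i) j) \<in> pipe n D k"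
  by (rule pipe_wire) (auto simp: wire_to_LeftEdge stair_def grid_def)

lemma TopEdge_in_pipe:
  "(i, j) \<in> grid n \<Longrightarrow> i + j \<le> n + 1 \<Longrightarrow> TopEdge i j \<in> pipe n D k \<longleftrightarrow>
    (if i + j \<le> n \<and> (i, j) \<in> D then TopEdge (Suc i) j else LeftEdge i j) \<in> pipe n D k"
  by (rule pipe_wire) (auto simp: wire_to_TopEdge)

text \<open>For a set \<open>U\<close> of cells closed under moving down and left, the edges which separate \<open>U\<close> from
  the rest of the staircase form a lattice path, with one edge for each value of \<open>edge_index\<close>.\<close>

fun frontier :: "nat \<Rightarrow> (nat \<times> nat) set \<Rightarrow> edge \<Rightarrow> bool" where
  "frontier n U (LeftEdge i j) \<longleftrightarrow>
     (i, j) \<in> grid n \<and> i + j \<le> n + 1 \<and> (i, j) \<notin> U \<and> (j = 1 \<or> (i, j - 1) \<in> U)"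
| "frontier n U (TopEdge i j) \<longleftrightarrow>
     (i, j) \<in> grid n \<and> i + j \<le> n + 1 \<and> (i, j) \<in> U \<and> (i = 1 \<or> (i - 1, j) \<notin> U)"

fun edge_index :: "edge \<Rightarrow> nat" where
  "edge_index (LeftEdge i j) = i + j - 1"
| "edge_index (TopEdge i j) = i + j - 1"

definition SW_closed :: "nat \<Rightarrow> (nat \<times> nat) set \<Rightarrow> bool" where
  "SW_closed n U \<longleftrightarrow> U \<subseteq> grid n \<and> (\<forall>s\<in>U. \<forall>t\<in>grid n. le_NE s t \<longrightarrow> t \<in> U)"

lemma SW_closedD: "SW_closed n U \<Longrightarrow> (i, j) \<in> U \<Longrightarrow> i \<le> i' \<Longrightarrow> i' \<le> n \<Longrightarrow> 1 \<le> j' \<Longrightarrow> j' \<le> j \<Longrightarrow> (i', j') \<in> U"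
  unfolding SW_closed_def le_NE_def grid_def by force

lemma listing_suffix_SW_closed:
  assumes "listing n (xs @ ys)"
  shows "SW_closed n (set ys)"
  using assms unfolding listing_def SW_closed_def by (auto simp: sorted_wrt_append)

text \<open>Frontier edges of equal index lie along one antidiagonal, where moving down also means
  moving left. Closure of \<open>U\<close> would then put some cell both inside and outside
  \<open>U\<close>.\<close>

lemma frontier_index_inj:
  assumes U: "SW_closed n U" and e: "frontier n U e" and f: "frontier n U f"
    and eq: "edge_index e = edge_index f"
  shows "e = f"
proof -
  have LL: "i = i'" if "frontier n U (LeftEdge i j)" "frontier n U (LeftEdge i' j')" "i + j = i' + j'" 
    for i j i' j'
  proof -
    have False if "i < i'" "frontier n U (LeftEdge i j)" "frontier n U (LeftEdge i' j')" "i + j = i' + j'"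
      for i j i' j'
    proof -
      have "j' \<le> j - 1" "j \<noteq> 1" "1 \<le> j'" "i' \<le> n" using that by (auto simp: grid_def)
      then show False using that SW_closedD[OF U, of i "j - 1" i' j'] by auto
    qed
    then show ?thesis using that by (metis linorder_neqE_nat)
  qed
  have TT: "i = i'" if "frontier n U (TopEdge i j)" "frontier n U (TopEdge i' j')" "i + j = i' + j'" 
    for i j i' j'
  proof -
    have False if "i < i'" "frontier n U (TopEdge i j)" "frontier n U (TopEdge i' j')" "i + j = i' + j'"
      for i j i' j'
    proof -
      have "i \<le> i' - 1" "i' \<noteq> 1" "j' \<le> j" "1 \<le> j'" "i' - 1 \<le> n" using that by (auto simp: grid_def)
      then show False using that SW_closedD[OF U, of i j "i' - 1" j'] by auto
    qed
    then show ?thesis using that by (metis linorder_neqE_nat)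
  qed
  have LT: False if "frontier n U (LeftEdge i j)" "frontier n U (TopEdge i' j')" "i + j = i' + j'" 
    for i j i' j'
  proof (cases "i' \<le> i")
    case True
    then show False using that SW_closedD[OF U, of i' j' i j] by (auto simp: grid_def)
  next
    case False
    then have "i \<le> i' - 1" "i' \<noteq> 1" "j' \<le> j - 1" "j \<noteq> 1" "1 \<le> j'" "i' - 1 \<le> n"
      using that by (auto simp: grid_def)
    then show False using that SW_closedD[OF U, of i "j - 1" "i' - 1" j'] by auto
  qed
  have pos: "frontier n U (LeftEdge i j) \<Longrightarrow> 1 \<le> i \<and> 1 \<le> j" "frontier n U (TopEdge i j) \<Longrightarrow> 1 \<le> i \<and> 1 \<le> j" for i j
    by (auto simp: grid_def)
  show ?thesis
  proof (cases e; cases f)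
    fix i j i' j' assume [simp]: "e = LeftEdge i j" "f = LeftEdge i' j'"
    have "i + j = i' + j'" using eq e f pos[of i j] pos[of i' j'] by (auto simp del: frontier.simps)
    then show ?thesis using LL[of i j i' j'] e f by simp
  next
    fix i j i' j' assume [simp]: "e = TopEdge i j" "f = TopEdge i' j'"
    have "i + j = i' + j'" using eq e f pos[of i j] pos[of i' j'] by (auto simp del: frontier.simps)
    then show ?thesis using TT[of i j i' j'] e f by simp
  next
    fix i j i' j' assume [simp]: "e = LeftEdge i j" "f = TopEdge i' j'"
    have "i + j = i' + j'" using eq e f pos[of i j] pos[of i' j'] by (auto simp del: frontier.simps)
    then show ?thesis using LT[of i j i' j'] e f by simp
  next
    fix i j i' j' assume [simp]: "e = TopEdge i j" "f = LeftEdge i' j'"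
    have "i' + j' = i + j" using eq e f pos[of i j] pos[of i' j'] by (auto simp del: frontier.simps)
    then show ?thesis using LT[of i' j' i j] e f by simp
  qed
qed

lemma frontier_insert_cases:
  assumes "frontier n (insert (i, j) U) e"
  shows "frontier n U e \<or> e = TopEdge i j \<or> e = LeftEdge i (Suc j)"
  using assms by (cases e) (auto split: if_splits)

text \<open>Scanning a cell with letter \<open>a\<close> replaces its left and bottom edges, of
  index \<open>a\<close> and \<open>a + 1\<close>, by its top and right edges, again of index
  \<open>a\<close> and \<open>a + 1\<close>. A crossing exchanges the indices of the two pipes; an
  avoidance keeps them.\<close>

lemma frontier_pipe:
  assumes "listing n (xs @ ys)" "D \<subseteq> stair n" "frontier n (set ys) e"
  shows "e \<in> pipe n D p \<longleftrightarrow> word_prod (cells_word D ys) p = edge_index e"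
  using assms(1,3)
proof (induction ys arbitrary: xs e)
  case Nil
  then show ?case by (cases e) (auto simp: LeftEdge_1_in_pipe id_apply)
next
  case (Cons c ys)
  obtain i j where c: "c = (i, j)" by (cases c)
  let ?U = "set ys" and ?v = "word_prod (cells_word D ys)"
  have list: "listing n ((xs @ [c]) @ ys)" using Cons.prems(1) by simp
  note IH = Cons.IH[OF list]
  have U: "SW_closed n ?U" by (rule listing_suffix_SW_closed[OF list])
  have U': "SW_closed n (insert c ?U)" using listing_suffix_SW_closed[OF Cons.prems(1)] by simp
  have cU: "(i, j) \<notin> ?U" and cg: "(i, j) \<in> grid n" using Cons.prems(1) c by (auto simp: listing_def)
  have ij: "1 \<le> i" "1 \<le> j" "i \<le> n" "j \<le> n" using cg by (auto simp: grid_def)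
  have down: "i < n \<Longrightarrow> (Suc i, j) \<in> ?U" 
    using SW_closedD[OF U', of i j "Suc i" j] ij c by auto
  have left: "1 < j \<Longrightarrow> (i, j - 1) \<in> ?U" 
  proof -
    assume "1 < j"
    then have "1 \<le> j - 1" "j - 1 \<le> j" "j - 1 \<noteq> j" by linarith+
    then show ?thesis using SW_closedD[OF U', of i j i "j - 1"] ij c by auto
  qed
  \<comment> \<open>The bounds differ because a cell with \<open>i + j = n + 1\<close> carries a
    left-to-top path but none from its bottom edge.\<close>
  have frL: "frontier n ?U (LeftEdge i j)" if "i + j \<le> n + 1"
    using that left cU cg ij by (cases "j = 1") auto
  have frT: "frontier n ?U (TopEdge (Suc i) j)" if "i + j \<le> n"
    using that down cU cg by (auto simp: grid_def)
  note inL = IH[OF frL, simplified] and inT = IH[OF frT, simplified]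
  have word: "word_prod (cells_word D (c # ys)) p =
    (if c \<in> D then simple_refl (i + j - 1) (?v p) else ?v p)"
    by (simp add: c letter_def o_apply)
  have cD: "i + j \<le> n" if "c \<in> D" using that assms(2) c by (auto simp: stair_def)
  show ?case
  proof (cases "e = TopEdge i j \<or> e = LeftEdge i (Suc j)")
    case True
    then consider "e = TopEdge i j" "i + j \<le> n + 1" | "e = LeftEdge i (Suc j)" "i + j \<le> n"
      using Cons.prems(2) by auto
    then show ?thesis
    proof cases
      case 1
      then show ?thesis
        using ij cD inL inT unfolding word
        by (auto simp: TopEdge_in_pipe[OF cg 1(2)] c simple_refl_apply split: if_splits)
    next
      case 2
      have "(i, j) \<in> stair n" using 2 cg by (simp add: stair_def)
      then show ?thesis
        using 2 ij inL inT unfolding word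
        by (auto simp: LeftEdge_in_pipe c simple_refl_apply split: if_splits)
    qed
  next
    case False
    then have fr: "frontier n ?U e"
      using frontier_insert_cases[of n i j ?U e] Cons.prems(2) c by auto
    have eq: "e \<in> pipe n D p \<longleftrightarrow> ?v p = edge_index e" by (rule IH[OF fr])
    show ?thesis
    proof (cases "c \<in> D")
      case True
      \<comment> \<open>An edge untouched by the new crossing differs from the two edges consumed,
        so its index is neither of the two exchanged values.\<close>
      have "e \<noteq> LeftEdge i j" "e \<noteq> TopEdge (Suc i) j"
        using Cons.prems(2) c ij by auto
      then have "edge_index e \<noteq> i + j - 1" "edge_index e \<noteq> i + j"
        using frontier_index_inj[OF U fr frL] frontier_index_inj[OF U fr frT] cD[OF True] by auto
      then show ?thesis using eq True ij unfolding word by (auto simp: simple_refl_apply)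
    next
      case False
      then show ?thesis using eq word by simp
    qed
  qed
qed

section \<open>Meetings of pipes and roots\<close>

lemma frontier_cell:
  assumes "listing n (xs @ (i, j) # ys)"
  shows "i + j \<le> n + 1 \<Longrightarrow> frontier n (set ys) (LeftEdge i j)"
    and "i + j \<le> n \<Longrightarrow> frontier n (set ys) (TopEdge (Suc i) j)"
proof -
  have U: "SW_closed n (insert (i, j) (set ys))"
    using listing_suffix_SW_closed[OF assms] by simp
  have cU: "(i, j) \<notin> set ys" and cg: "(i, j) \<in> grid n" using assms by (auto simp: listing_def)
  have ij: "1 \<le> i" "1 \<le> j" "i \<le> n" "j \<le> n" using cg by (auto simp: grid_def)
  {
    assume "i + j \<le> n + 1"
    moreover have "(i, j - 1) \<in> set ys" if "j \<noteq> 1"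
    proof -
      have "1 \<le> j - 1" "j - 1 \<noteq> j" using that ij by linarith+
      then show ?thesis using SW_closedD[OF U, of i j i "j - 1"] ij by auto
    qed
    ultimately show "frontier n (set ys) (LeftEdge i j)" using cU cg by auto
  next
    assume "i + j \<le> n"
    moreover have "(Suc i, j) \<in> set ys" if "i < n"
      using SW_closedD[OF U, of i j "Suc i" j] that ij by auto
    ultimately show "frontier n (set ys) (TopEdge (Suc i) j)"
      using cU ij by (auto simp: grid_def)
  }
qed

text \<open>The two pipes enter \<open>c\<close> through its left and bottom edges, which lie on the
  frontier of the suffix. Only the cells after \<open>c\<close> matter, not whether \<open>c\<close>
  itself is a crossing, so crossings and avoidances can be compared.\<close>

lemma pipes_meet_iff:
  assumes "listing n (xs @ c # ys)" "D \<subseteq> stair n" "c \<in> stair n"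
  defines "v \<equiv> word_prod (cells_word D ys)"
  shows "pipes_meet n D p q c \<longleftrightarrow> {v p, v q} = {letter c, Suc (letter c)}"
proof -
  obtain i j where c: "c = (i, j)" by (cases c)
  have ij: "(i, j) \<in> grid n" "i + j \<le> n" "1 \<le> i" using assms(3) c by (auto simp: stair_def grid_def)
  have list: "listing n ((xs @ [c]) @ ys)" using assms(1) by simp
  have "LeftEdge i j \<in> pipe n D p \<longleftrightarrow> v p = letter c" for p
    using frontier_pipe[OF list assms(2) frontier_cell(1)[OF assms(1)[unfolded c]], of p] ij
    by (simp add: c letter_def v_def)
  moreover have "TopEdge (i + 1) j \<in> pipe n D p \<longleftrightarrow> v p = Suc (letter c)" for p
    using frontier_pipe[OF list assms(2) frontier_cell(2)[OF assms(1)[unfolded c]], of p] ij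
    by (simp add: c letter_def v_def One_nat_def)
  ultimately show ?thesis
    using ij by (auto simp: pipes_meet_def c doubleton_eq_iff)
qed

lemma card_pipes_cross:
  assumes "listing n (xs @ ys)" "D \<subseteq> stair n"
  shows "card {c \<in> set ys. pipes_cross n D p q c} = count_list (roots (cells_word D ys)) {p, q}"
  using assms(1)
proof (induction ys arbitrary: xs)
  case (Cons c ys)
  let ?v = "word_prod (cells_word D ys)" and ?P = "pipes_cross n D p q"
  have "listing n ((xs @ [c]) @ ys)" using Cons.prems by simp
  note IH = Cons.IH[OF this]
  have c: "c \<notin> set ys" using Cons.prems by (simp add: listing_def)
  show ?case
  proof (cases "c \<in> D")
    case True
    then have "?P c \<longleftrightarrow> {inv ?v (letter c), inv ?v (Suc (letter c))} = {p, q}"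
      using pipes_meet_iff[OF Cons.prems assms(2), of p q] assms(2)
      by (auto simp: pipes_cross_def inv_pair_eq_iff)
    moreover have "{d \<in> set (c # ys). ?P d} =
        (if ?P c then insert c {d \<in> set ys. ?P d} else {d \<in> set ys. ?P d})"
      by auto
    ultimately show ?thesis using True IH c by simp
  next
    case False
    then have "{d \<in> set (c # ys). ?P d} = {d \<in> set ys. ?P d}" by (auto simp: pipes_cross_def)
    then show ?thesis using False IH by simp
  qed
qed simp

lemma reduced_pipe_dream_iff:
  assumes "listing n cs" "D \<subseteq> grid n"
  shows "reduced_pipe_dream n D \<longleftrightarrow>
    D \<subseteq> stair n \<and> len (word_prod (cells_word D cs)) = length (cells_word D cs)"
proof -
  let ?as = "cells_word D cs"
  have "(\<forall>p\<in>{1..n}. \<forall>q\<in>{1..n}. p \<noteq> q \<longrightarrow> card {c. pipes_cross n D p q c} \<le> 1) \<longleftrightarrow>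
      len (word_prod ?as) = length ?as" if D: "D \<subseteq> stair n"
  proof -
    have as: "set ?as \<subseteq> {1..<n}"
      using assms D by (intro set_cells_word_subset(1)) (auto simp: listing_def)
    have card: "card {c. pipes_cross n D p q c} = count_list (roots ?as) {p, q}" for p q
    proof -
      have "{c. pipes_cross n D p q c} = {c \<in> set cs. pipes_cross n D p q c}"
        using assms by (auto simp: pipes_cross_def pipes_meet_def listing_def)
      then show ?thesis using card_pipes_cross[of n "[]" cs D p q] assms D by simp
    qed
    \<comment> \<open>Every root is a pair of distinct pipes, so bounding the multiplicity of such
      pairs bounds all multiplicities.\<close>
    have "(\<forall>p\<in>{1..n}. \<forall>q\<in>{1..n}. p \<noteq> q \<longrightarrow> count_list (roots ?as) {p, q} \<le> 1) \<longleftrightarrow>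
        (\<forall>P. count_list (roots ?as) P \<le> 1)"
    proof (intro iffI allI)
      fix P assume *: "\<forall>p\<in>{1..n}. \<forall>q\<in>{1..n}. p \<noteq> q \<longrightarrow> count_list (roots ?as) {p, q} \<le> 1"
      show "count_list (roots ?as) P \<le> 1"
      proof (cases "P \<in> set (roots ?as)")
        case True
        then show ?thesis using roots_elem[OF True as] * by fastforce
      qed simp
    qed simp
    then show ?thesis
      unfolding card len_eq_length_iff_distinct[OF as] distinct_iff_count_list_le_1 .
  qed
  then show ?thesis unfolding reduced_pipe_dream_def stair_def[symmetric] by blast
qed

text \<open>Once every cell is scanned, the frontier is the top boundary, where the edge in column
  \<open>j\<close> has index \<open>j\<close>.\<close>

lemma TopEdge_1_in_pipe_iff:
  assumes "listing n cs" "D \<subseteq> stair n" "j \<in> {1..n}"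
  shows "TopEdge 1 j \<in> pipe n D p \<longleftrightarrow> word_prod (cells_word D cs) p = j"
proof -
  have "frontier n (set cs) (TopEdge 1 j)" using assms by (auto simp: listing_def grid_def)
  then show ?thesis using frontier_pipe[of n "[]" cs D "TopEdge 1 j" p] assms by simp
qed

lemma PD_iff:
  assumes "listing n cs" "D \<subseteq> grid n" "w \<in> Sym n"
  shows "D \<in> PD n w \<longleftrightarrow>
    D \<subseteq> stair n \<and> len w = length (cells_word D cs) \<and> word_prod (cells_word D cs) = w"
proof -
  let ?u = "word_prod (cells_word D cs)"
  have "(\<forall>i\<in>{1..n}. TopEdge 1 (w i) \<in> pipe n D i) \<longleftrightarrow> ?u = w" if D: "D \<subseteq> stair n"
  proof -
    have wi: "w i \<in> {1..n}" if "i \<in> {1..n}" for i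
      using assms(3) permutes_in_image[of w "{1..n}"] that by (simp add: Sym_def)
    have "set (cells_word D cs) \<subseteq> {1..<n}"
      using assms D by (intro set_cells_word_subset(1)) (auto simp: listing_def)
    then have "?u \<in> Sym n" by (rule word_prod_in_Sym)
    then have "?u i = i" "w i = i" if "i \<notin> {1..n}" for i
      using assms(3) that by (auto simp: Sym_def permutes_not_in)
    then have "?u = w \<longleftrightarrow> (\<forall>i\<in>{1..n}. ?u i = w i)" by (metis ext)
    then show ?thesis using TopEdge_1_in_pipe_iff[OF assms(1) D] wi by blast
  qed
  then show ?thesis using reduced_pipe_dream_iff[OF assms(1,2)] by (auto simp: PD_def)
qed

text \<open>The right-hand side does not mention the listing; this is why all reading words behave
  alike.\<close>

lemma involution_word_cells_word_iff:
  assumes "listing n cs" "D \<subseteq> grid n"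
  shows "involution_word n z (cells_word D cs) \<longleftrightarrow> (\<exists>w. atom n z w \<and> D \<in> PD n w)"
proof -
  have "set (cells_word D cs) \<subseteq> {1..<n} \<longleftrightarrow> D \<subseteq> stair n"
    using assms set_cells_word_subset[of D n cs] by (auto simp: listing_def)
  moreover have "w \<in> Sym n" if "atom n z w" for w using that by (simp add: atom_def)
  ultimately show ?thesis
    unfolding involution_word_iff_atom using PD_iff[OF assms] by metis
qed

section \<open>Reading orders as listings\<close>

lemma reading_word_eq:
  assumes "reading_order n \<omega>" "D \<subseteq> grid n"
  shows "\<exists>cs. listing n cs \<and> reading_word n \<omega> D = cells_word D cs"
proof -
  let ?g = "inv_into (grid n) \<omega>"
  \<comment> \<open>The whole grid is listed by increasing \<open>\<omega>\<close>; keeping the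
    cells of \<open>D\<close> then gives the same order as sorting the values of
    \<open>\<omega>\<close> on \<open>D\<close>.\<close>
  define cs where "cs = map ?g [1..<Suc (n\<^sup>2)]"
  have bij: "bij_betw \<omega> (grid n) {1..n\<^sup>2}"
    and mono: "\<And>s t. s \<in> grid n \<Longrightarrow> t \<in> grid n \<Longrightarrow> le_NE s t \<Longrightarrow> s \<noteq> t \<Longrightarrow> \<omega> s < \<omega> t"
    using assms(1) by (auto simp: reading_order_def)
  have bij': "bij_betw ?g {1..n\<^sup>2} (grid n)" by (rule bij_betw_inv_into[OF bij])
  have inv: "\<omega> (?g k) = k" if "k \<in> {1..n\<^sup>2}" for k
    using bij that by (simp add: bij_betw_inv_into_right)
  have set: "set [1..<Suc (n\<^sup>2)] = {1..n\<^sup>2}" by auto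
  have "listing n cs"
    unfolding listing_def
  proof (intro conjI)
    show "distinct cs" unfolding cs_def distinct_map set using bij' by (simp add: bij_betw_def)
    show "set cs = grid n" unfolding cs_def set_map set using bij' by (simp add: bij_betw_def)
    have "sorted_wrt (<) [1..<Suc (n\<^sup>2)]" by (rule sorted_wrt_upt)
    then have "sorted_wrt (\<lambda>k l. \<not> le_NE (?g l) (?g k)) [1..<Suc (n\<^sup>2)]"
    proof (rule sorted_wrt_mono_rel[rotated])
      fix k l assume kl: "k \<in> set [1..<Suc (n\<^sup>2)]" "l \<in> set [1..<Suc (n\<^sup>2)]" "k < l"
      then have "?g k \<in> grid n" "?g l \<in> grid n" "\<omega> (?g k) < \<omega> (?g l)"
        using bij' inv unfolding set by (auto simp: bij_betw_def)
      then show "\<not> le_NE (?g l) (?g k)" using mono[of "?g l" "?g k"] by (cases "?g l = ?g k") auto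
    qed
    then show "sorted_wrt (\<lambda>s t. \<not> le_NE t s) cs" by (simp add: cs_def sorted_wrt_map del: upt_Suc)
  qed
  moreover have "sorted_list_of_set (\<omega> ` D) = filter (\<lambda>k. ?g k \<in> D) [1..<Suc (n\<^sup>2)]"
  proof (rule sorted_distinct_set_unique)
    have "\<omega> ` D = {k \<in> {1..n\<^sup>2}. ?g k \<in> D}"
    proof (intro equalityI subsetI)
      fix k assume "k \<in> \<omega> ` D"
      then obtain d where "d \<in> D" "k = \<omega> d" by blast
      moreover from this have "\<omega> d \<in> {1..n\<^sup>2}"
        using assms(2) bij unfolding bij_betw_def by blast
      ultimately show "k \<in> {k \<in> {1..n\<^sup>2}. ?g k \<in> D}"
        using assms(2) bij by (auto simp: bij_betw_inv_into_left)
    next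
      fix k assume "k \<in> {k \<in> {1..n\<^sup>2}. ?g k \<in> D}"
      then show "k \<in> \<omega> ` D" using inv[of k] by (metis (mono_tags, lifting) image_eqI mem_Collect_eq)
    qed
    moreover have "finite D" by (rule finite_subset[OF assms(2)]) (simp add: grid_def)
    ultimately show "set (sorted_list_of_set (\<omega> ` D)) = set (filter (\<lambda>k. ?g k \<in> D) [1..<Suc (n\<^sup>2)])"
      using set by auto
  qed (auto intro: sorted_wrt_filter simp del: upt_Suc)
  then have "reading_word n \<omega> D = cells_word D cs"
    by (simp add: reading_word_def cells_word_def cs_def filter_map o_def letter_def case_prod_unfold del: upt_Suc)
  ultimately show ?thesis by blast
qed

lemma ex_reading_order: "\<exists>\<omega>. reading_order n \<omega>"
proof -
  \<comment> \<open>Rows from top to bottom, each from right to left; the final 1 makes the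
    numbering start at 1.\<close>
  define \<omega> where "\<omega> = (\<lambda>(i, j). (i - 1) * n + (n - j) + 1)"
  have mono: "\<omega> (i, j) < \<omega> (i', j')"
    if "(i, j) \<in> grid n" "(i', j') \<in> grid n" "i < i' \<or> i = i' \<and> j' < j" for i j i' j'
    using that(3)
  proof
    assume "i < i'"
    then have "(i - 1) * n + n \<le> (i' - 1) * n"
    proof -
      have "Suc (i - 1) \<le> i' - 1" using \<open>i < i'\<close> that(1) by (simp add: grid_def)
      then have "Suc (i - 1) * n \<le> (i' - 1) * n" by (rule mult_le_mono1)
      then show ?thesis by simp
    qed
    moreover have "n - j < n" using that by (auto simp: grid_def)
    ultimately show ?thesis by (simp add: \<omega>_def)
  next
    assume "i = i' \<and> j' < j"
    then show ?thesis using that by (auto simp: \<omega>_def grid_def)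
  qed
  have inj: "inj_on \<omega> (grid n)"
  proof (rule inj_onI, clarify)
    fix i j i' j' assume *: "(i, j) \<in> grid n" "(i', j') \<in> grid n" "\<omega> (i, j) = \<omega> (i', j')"
    show "i = i' \<and> j = j'"
      using mono[OF *(1,2)] mono[OF *(2,1)] *(3) by (metis linorder_neqE_nat less_irrefl)
  qed
  have "\<omega> ` grid n \<subseteq> {1..n\<^sup>2}"
  proof (clarify)
    fix i j assume ij: "(i, j) \<in> grid n"
    have "(i - 1) * n + n \<le> (n - 1) * n + n" using ij by (auto simp: grid_def)
    also have "\<dots> = n\<^sup>2" using ij by (cases n) (auto simp: grid_def power2_eq_square)
    finally show "\<omega> (i, j) \<in> {1..n\<^sup>2}" using ij by (auto simp: \<omega>_def grid_def)
  qed
  moreover have "card (\<omega> ` grid n) = card {1..n\<^sup>2}"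
    by (simp add: card_image[OF inj]) (simp add: grid_def power2_eq_square id_apply)
  ultimately have "bij_betw \<omega> (grid n) {1..n\<^sup>2}"
    using inj unfolding bij_betw_def by (metis card_subset_eq finite_atLeastAtMost)
  moreover have "\<omega> s < \<omega> t" if "s \<in> grid n" "t \<in> grid n" "le_NE s t" "s \<noteq> t" for s t
  proof -
    have "fst s < fst t \<or> fst s = fst t \<and> snd t < snd s" using that(3,4) by (auto simp: le_NE_def prod_eq_iff)
    then show ?thesis using that(1,2) mono[of "fst s" "snd s" "fst t" "snd t"] by simp
  qed
  ultimately show ?thesis unfolding reading_order_def by blast
qed

section \<open>Lengths of involution words\<close>

lemma Invol_iff: "y \<in> Invol n \<longleftrightarrow> y \<in> Sym n \<and> (\<forall>x. y (y x) = x)"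
proof -
  have "y = inv y \<longleftrightarrow> (\<forall>x. y (y x) = x)" if "y \<in> Sym n"
    using Sym_bij[OF that] by (metis bij_inv_eq_iff ext)
  then show ?thesis by (auto simp: Invol_def)
qed

lemma id_in_Invol [simp]: "id \<in> Invol n"
  by (simp add: Invol_iff id_apply)

text \<open>After a left multiplication at an ascent, the right one is absorbed only if
  \<open>y\<close> preserves the pair \<open>{a, Suc a}\<close>. At an ascent this means fixing both
  points, and then \<open>s y = y s\<close>.\<close>

lemma istep_cases:
  assumes y: "y \<in> Invol n" and a: "a \<in> {1..<n}"
  shows "y a < y (Suc a) \<Longrightarrow> y a = a \<and> y (Suc a) = Suc a \<Longrightarrow>
      istep a y = y \<circ> simple_refl a \<and> simple_refl a \<circ> y = y \<circ> simple_refl a"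
    and "y a < y (Suc a) \<Longrightarrow> \<not> (y a = a \<and> y (Suc a) = Suc a) \<Longrightarrow>
      istep a y = simple_refl a \<circ> y \<circ> simple_refl a \<and> len (istep a y) = len y + 2"
    and "\<not> y a < y (Suc a) \<Longrightarrow> istep a y = y"
proof -
  let ?s = "simple_refl a"
  have yS: "y \<in> Sym n" and inv: "inv y = y" using y by (auto simp: Invol_def)
  have yy: "y (y x) = x" for x using y by (simp add: Invol_iff)
  have lmul: "lmul a y = (if y a < y (Suc a) then ?s \<circ> y else y)" by (simp add: lmul_def inv)
  {
    assume asc: "y a < y (Suc a)" and fx: "y a = a \<and> y (Suc a) = Suc a"
    have "?s \<circ> y = y \<circ> ?s"
    proof
      fix x
      have "y x = a \<longleftrightarrow> x = a" "y x = Suc a \<longleftrightarrow> x = Suc a" using fx yy by metis+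
      then show "(?s \<circ> y) x = (y \<circ> ?s) x" using fx by (auto simp: simple_refl_apply o_apply)
    qed
    then show "istep a y = y \<circ> ?s \<and> ?s \<circ> y = y \<circ> ?s"
      using asc fx by (simp add: istep_def lmul rmul_descent o_apply simple_refl_apply)
  next
    assume asc: "y a < y (Suc a)" and nfix: "\<not> (y a = a \<and> y (Suc a) = Suc a)"
    have "{y a, y (Suc a)} \<noteq> {a, Suc a}" using asc nfix by (auto simp: doubleton_eq_iff)
    then have asc': "(?s \<circ> y) a < (?s \<circ> y) (Suc a)"
      using asc simple_refl_less_iff by (simp add: o_apply)
    then have "istep a y = ?s \<circ> y \<circ> ?s" using asc by (simp add: istep_def lmul rmul_ascent)
    moreover have "?s \<circ> y \<in> Sym n" using a yS by (simp add: Sym_comp simple_refl_in_Sym)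
    moreover have "len (?s \<circ> y) = Suc (len y)"
      using len_simple_refl_comp_ascent[OF yS a] asc by (simp add: inv)
    ultimately show "istep a y = ?s \<circ> y \<circ> ?s \<and> len (istep a y) = len y + 2"
      using len_ascent[OF finite_invs asc'] by simp
  next
    assume "\<not> y a < y (Suc a)"
    then show "istep a y = y" by (simp add: istep_def lmul rmul_descent)
  }
qed

lemma istep_in_Invol:
  assumes y: "y \<in> Invol n" and a: "a \<in> {1..<n}"
  shows "istep a y \<in> Invol n"
proof -
  have S: "istep a y \<in> Sym n" using y a by (simp add: istep_in_Sym Invol_iff)
  have yy: "y (y x) = x" for x using y by (simp add: Invol_iff)
  consider "y a < y (Suc a)" "y a = a \<and> y (Suc a) = Suc a"
    | "y a < y (Suc a)" "\<not> (y a = a \<and> y (Suc a) = Suc a)" | "\<not> y a < y (Suc a)" by blast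
  then show ?thesis
  proof cases
    case 1
    then have "istep a y = y \<circ> simple_refl a" "simple_refl a \<circ> y = y \<circ> simple_refl a"
      using istep_cases(1)[OF assms] by auto
    then have "istep a y (istep a y x) = x" for x
      using yy by (metis o_apply simple_refl_invol)
    then show ?thesis using S by (simp add: Invol_iff)
  next
    case 2
    then show ?thesis using istep_cases(2)[OF assms] S yy by (simp add: Invol_iff o_apply)
  next
    case 3
    then show ?thesis using istep_cases(3)[OF assms] y by simp
  qed
qed

lemma isteps_in_Invol:
  "y \<in> Invol n \<Longrightarrow> set as \<subseteq> {1..<n} \<Longrightarrow> fold istep as y \<in> Invol n"
  by (induction as arbitrary: y) (auto simp: istep_in_Invol)

text \<open>An involution moves two points per 2-cycle, so both \<open>s y s\<close> and \<open>y s\<close> raise the weight of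
  \<open>y\<close> by the same amount, 4, when they are longer than \<open>y\<close>.\<close>

definition weight :: "(nat \<Rightarrow> nat) \<Rightarrow> nat" where
  "weight y = 2 * len y + card {x. y x \<noteq> x}"

text \<open>If both points are fixed, the length contributes 2 and the new 2-cycle moves 2 more
  points. Otherwise the length contributes 4 and conjugation preserves the number of moved
  points.\<close>

lemma weight_istep:
  assumes y: "y \<in> Invol n" and a: "a \<in> {1..<n}" and asc: "y a < y (Suc a)"
  shows "weight (istep a y) = weight y + 4"
proof (cases "y a = a \<and> y (Suc a) = Suc a")
  case True
  have yS: "y \<in> Sym n" using y by (simp add: Invol_iff)
  have i: "istep a y = y \<circ> simple_refl a" using istep_cases(1)[OF y a asc True] by blast
  have "istep a y x \<noteq> x \<longleftrightarrow> x = a \<or> x = Suc a \<or> y x \<noteq> x" for x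
    using True by (simp add: i o_apply simple_refl_apply)
  then have "{x. istep a y x \<noteq> x} = insert a (insert (Suc a) {x. y x \<noteq> x})" by blast
  moreover have "finite {x. y x \<noteq> x}"
    using yS permutes_imp_permutation[of "{1..n}" y] by (simp add: Sym_def permutation)
  ultimately have "card {x. istep a y x \<noteq> x} = card {x. y x \<noteq> x} + 2" using True by simp
  then show ?thesis using len_ascent[OF finite_invs[OF yS] asc] by (simp add: weight_def i)
next
  case False
  let ?s = "simple_refl a"
  have i: "istep a y = ?s \<circ> y \<circ> ?s" "len (istep a y) = len y + 2"
    using istep_cases(2)[OF y a asc False] by auto
  have "bij_betw ?s {x. y x \<noteq> x} {x. istep a y x \<noteq> x}"
  proof (rule bij_betwI[of _ _ _ ?s])
    have "?s u = v \<longleftrightarrow> u = ?s v" for u v by (metis simple_refl_invol)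
    then show "?s \<in> {x. y x \<noteq> x} \<rightarrow> {x. istep a y x \<noteq> x}"
      "?s \<in> {x. istep a y x \<noteq> x} \<rightarrow> {x. y x \<noteq> x}"
      by (simp_all add: i(1) o_apply)
  qed simp_all
  then show ?thesis using i(2) by (simp add: weight_def bij_betw_same_card)
qed

lemma weight_istep_le:
  "y \<in> Invol n \<Longrightarrow> a \<in> {1..<n} \<Longrightarrow> weight (istep a y) \<le> weight y + 4"
  by (cases "y a < y (Suc a)") (simp_all add: weight_istep istep_cases(3))

lemma weight_isteps_le:
  "y \<in> Invol n \<Longrightarrow> set as \<subseteq> {1..<n} \<Longrightarrow> weight (fold istep as y) \<le> weight y + 4 * length as"
proof (induction as arbitrary: y)
  case (Cons a as)
  then have "weight (fold istep as (istep a y)) \<le> weight (istep a y) + 4 * length as"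
    by (intro Cons.IH istep_in_Invol) auto
  moreover have "weight (istep a y) \<le> weight y + 4" using Cons.prems by (intro weight_istep_le) auto
  ultimately show ?case by simp
qed simp

lemma weight_id [simp]: "weight id = 0"
  by (simp add: weight_def id_apply)

text \<open>Letters that leave the current involution unchanged can be deleted; each remaining
  letter adds 4.\<close>

lemma ex_strict_isteps:
  "set as \<subseteq> {1..<n} \<Longrightarrow>
    \<exists>bs. set bs \<subseteq> {1..<n} \<and> fold istep bs id = fold istep as id \<and> weight (fold istep as id) = 4 * length bs"
proof (induction as rule: rev_induct)
  case (snoc a as)
  then obtain bs where bs: "set bs \<subseteq> {1..<n}" "fold istep bs id = fold istep as id"
    "weight (fold istep as id) = 4 * length bs" by auto
  let ?y = "fold istep as id"
  have a: "a \<in> {1..<n}" and y: "?y \<in> Invol n" using snoc.prems by (auto intro!: isteps_in_Invol)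
  show ?case
  proof (cases "?y a < ?y (Suc a)")
    case True
    then show ?thesis using bs a weight_istep[OF y a] by (intro exI[of _ "bs @ [a]"]) simp
  next
    case False
    then show ?thesis using bs istep_cases(3)[OF y a] by (intro exI[of _ bs]) simp
  qed
qed (simp add: exI[of _ "[]"])

lemma involution_word_iff_weight:
  assumes "set as \<subseteq> {1..<n}"
  shows "involution_word n z as \<longleftrightarrow> z = fold istep as id \<and> weight z = 4 * length as"
proof
  assume "involution_word n z as"
  then have z: "z = fold istep as id"
    and min: "\<And>bs. set bs \<subseteq> {1..<n} \<Longrightarrow> z = fold istep bs id \<Longrightarrow> length as \<le> length bs"
    using demazure_conj_eq assms by (auto simp: involution_word_def)
  obtain bs where "set bs \<subseteq> {1..<n}" "fold istep bs id = z" "weight z = 4 * length bs"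
    using ex_strict_isteps[OF assms] z by blast
  then show "z = fold istep as id \<and> weight z = 4 * length as"
    using z min[of bs] weight_isteps_le[OF id_in_Invol assms] by simp
next
  assume z: "z = fold istep as id \<and> weight z = 4 * length as"
  have "length as \<le> length bs" if "set bs \<subseteq> {1..<n}" "z = fold istep bs id" for bs
  proof -
    have "weight z \<le> 4 * length bs" using weight_isteps_le[OF id_in_Invol that(1)] that(2) by simp
    moreover have "weight z = 4 * length as" using z by blast
    ultimately show ?thesis by linarith
  qed
  then show "involution_word n z as"
    using z assms by (auto simp: involution_word_def demazure_conj_eq)
qed

text \<open>The maximal total gain is possible only if each part of the word has maximal
  gain.\<close>

lemma weight_prefix:
  assumes "set (as @ bs) \<subseteq> {1..<n}" "weight (fold istep (as @ bs) id) = 4 * length (as @ bs)"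
  shows "weight (fold istep as id) = 4 * length as"
proof -
  have as: "set as \<subseteq> {1..<n}" and bs: "set bs \<subseteq> {1..<n}" using assms(1) by auto
  have "weight (fold istep bs (fold istep as id)) \<le> weight (fold istep as id) + 4 * length bs"
    by (rule weight_isteps_le[OF isteps_in_Invol[OF id_in_Invol as] bs])
  moreover have "weight (fold istep as id) \<le> 4 * length as"
    using weight_isteps_le[OF id_in_Invol as] by simp
  ultimately show ?thesis using assms(2) by simp
qed

text \<open>A factor that is not reduced could be replaced by a shorter word, shortening the
  whole.\<close>

lemma reduced_factor:
  assumes "set (xs @ ys @ zs) \<subseteq> {1..<n}" "len (word_prod (xs @ ys @ zs)) = length (xs @ ys @ zs)"
  shows "len (word_prod ys) = length ys"
proof -
  have ys: "set ys \<subseteq> {1..<n}" using assms by auto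
  obtain bs where bs: "set bs \<subseteq> {1..<n}" "word_prod bs = word_prod ys" "length bs = len (word_prod ys)"
    using ex_reduced_word[OF word_prod_in_Sym[OF ys]] by blast
  have "len (word_prod (xs @ bs @ zs)) \<le> length (xs @ bs @ zs)"
    using assms bs by (intro len_word_prod_le[of _ n]) auto
  then have "length ys \<le> length bs" using assms(2) bs(2) by (simp add: word_prod_append)
  then show ?thesis using bs(3) len_word_prod_le[OF ys] by simp
qed

section \<open>Almost-symmetric pipe dreams\<close>

definition diag_cells :: "nat \<Rightarrow> (nat \<times> nat) list" where
  "diag_cells n = map (\<lambda>i. (i, i)) [1..<Suc n]"

text \<open>Transposition reverses the NE order, so the transposed cells come first and in reverse.
  Appending a cell of \<open>E\<close> to \<open>l\<close> adds its letter on the right and, if the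
  transposed cell is in \<open>E\<close>, the same letter on the left.\<close>

definition symmetric_word :: "nat \<Rightarrow> (nat \<times> nat) set \<Rightarrow> (nat \<times> nat) list \<Rightarrow> nat list" where
  "symmetric_word n E l = cells_word E (rev (map prod.swap l)) @ cells_word E (diag_cells n) @ cells_word E l"

text \<open>The involution built by the first cells of a lower triangular listing coincides with the
  permutation read off from these cells and their transposes, along with the diagonal.\<close>

definition balanced :: "nat \<Rightarrow> (nat \<times> nat) set \<Rightarrow> (nat \<times> nat) list \<Rightarrow> bool" where
  "balanced n E l \<longleftrightarrow>
     (let y = word_prod (symmetric_word n E l); as = cells_word E (diag_cells n @ l) in
        fold istep as id = y \<and> len y = length (symmetric_word n E l) \<and> weight y = 4 * length as)"

lemma letter_swap [simp]: "letter (prod.swap c) = letter c"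
  by (simp add: letter_def add.commute)

lemma letter_stair: "c \<in> stair n \<Longrightarrow> letter c \<in> {1..<n}"
  by (auto simp: stair_def grid_def letter_def)

lemma balanced_Nil:
  assumes "E \<subseteq> stair n"
  shows "balanced n E []"
proof -
  \<comment> \<open>The diagonal letters are 1, 3, 5 and so on. The first \<open>m\<close> cells
    move no point beyond \<open>2 * m\<close>, so the next letter \<open>2 * m + 1\<close> meets two
    fixed points and no conjugation occurs.\<close>
  have "\<forall>x>2 * m. word_prod (cells_word E (diag_cells m)) x = x"
    and "fold istep (cells_word E (diag_cells m)) id = word_prod (cells_word E (diag_cells m))"
    and "len (word_prod (cells_word E (diag_cells m))) = length (cells_word E (diag_cells m))"
    and "weight (word_prod (cells_word E (diag_cells m))) = 4 * length (cells_word E (diag_cells m))" for m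
  proof (induction m)
    case 0
    { case 1 show ?case by (simp add: diag_cells_def id_apply)
    next case 2 show ?case by (simp add: diag_cells_def id_apply)
    next case 3 show ?case by (simp add: diag_cells_def)
    next case 4 show ?case by (simp add: diag_cells_def) }
  next
    case (Suc m)
    let ?as = "cells_word E (diag_cells m)" and ?a = "2 * m + 1"
    let ?y = "word_prod ?as"
    have d: "diag_cells (Suc m) = diag_cells m @ [(Suc m, Suc m)]" by (simp add: diag_cells_def)
    show "\<forall>x>2 * Suc m. word_prod (cells_word E (diag_cells (Suc m))) x = x"
      using Suc(1) by (auto simp: d letter_def word_prod_append o_apply id_apply simple_refl_apply)
    have "fold istep (cells_word E (diag_cells (Suc m))) id = word_prod (cells_word E (diag_cells (Suc m))) \<and>
      len (word_prod (cells_word E (diag_cells (Suc m)))) = length (cells_word E (diag_cells (Suc m))) \<and>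
      weight (word_prod (cells_word E (diag_cells (Suc m)))) = 4 * length (cells_word E (diag_cells (Suc m)))"
    proof (cases "(Suc m, Suc m) \<in> E")
      case False
      then show ?thesis using Suc by (simp add: d)
    next
      case True
      then have "(Suc m, Suc m) \<in> stair n" using assms by blast
      then have a: "?a \<in> {1..<n}" by (simp add: stair_def)
      have "set (diag_cells m) \<subseteq> grid n" using a by (auto simp: diag_cells_def grid_def)
      then have as: "set ?as \<subseteq> {1..<n}"
        using assms by (intro set_cells_word_subset(1)) (auto simp: stair_def)
      have y: "?y \<in> Invol n" using isteps_in_Invol[OF id_in_Invol as] Suc(2) by simp
      have fx: "?y ?a = ?a \<and> ?y (Suc ?a) = Suc ?a" using Suc(1) by simp
      then have asc: "?y ?a < ?y (Suc ?a)" by simp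
      have "cells_word E (diag_cells (Suc m)) = ?as @ [?a]"
        using True by (simp add: d letter_def)
      then show ?thesis
        using Suc(2-4) istep_cases(1)[OF y a asc fx] weight_istep[OF y a asc]
          len_ascent[OF finite_invs[of ?y n] asc] y
        by (simp add: word_prod_append Invol_iff)
    qed
    then show "fold istep (cells_word E (diag_cells (Suc m))) id = word_prod (cells_word E (diag_cells (Suc m)))"
      "len (word_prod (cells_word E (diag_cells (Suc m)))) = length (cells_word E (diag_cells (Suc m)))"
      "weight (word_prod (cells_word E (diag_cells (Suc m)))) = 4 * length (cells_word E (diag_cells (Suc m)))"
      by auto
  qed
  then show ?thesis by (simp add: balanced_def symmetric_word_def Let_def)
qed

text \<open>The assumption \<open>asc\<close> makes the letter effective; \<open>sym\<close>
  supplies the transposed cell exactly when the step is a conjugation and the letter is needed on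
  both sides.\<close>

lemma balanced_snoc:
  fixes n E l
  defines "y \<equiv> word_prod (symmetric_word n E l)"
  assumes bal: "balanced n E l" and E: "E \<subseteq> stair n" and l: "set l \<subseteq> grid n"
    and up: "prod.swap c \<in> E \<Longrightarrow> c \<in> E"
    and asc: "c \<in> E \<Longrightarrow> y (letter c) < y (Suc (letter c))"
    and sym: "c \<in> E \<Longrightarrow> prod.swap c \<in> E \<longleftrightarrow> \<not> (y (letter c) = letter c \<and> y (Suc (letter c)) = Suc (letter c))"
  shows "balanced n E (l @ [c])"
proof (cases "c \<in> E")
  case False
  then show ?thesis using bal up by (auto simp: balanced_def symmetric_word_def)
next
  case True
  let ?a = "letter c" and ?as = "cells_word E (diag_cells n @ l)"
  have a: "?a \<in> {1..<n}" using True E letter_stair by blast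
  have "set (diag_cells n @ l) \<subseteq> grid n" using l by (auto simp: diag_cells_def grid_def)
  then have as: "set ?as \<subseteq> {1..<n}"
    using E by (intro set_cells_word_subset(1)) (auto simp: stair_def)
  have y1: "fold istep ?as id = y" and y2: "len y = length (symmetric_word n E l)"
    and y3: "weight y = 4 * length ?as"
    using bal by (auto simp: balanced_def Let_def y_def)
  have y: "y \<in> Invol n" using isteps_in_Invol[OF id_in_Invol as] y1 by simp
  have as': "cells_word E (diag_cells n @ l @ [c]) = ?as @ [?a]" using True by simp
  have w: "symmetric_word n E (l @ [c]) =
      (if prod.swap c \<in> E then [?a] else []) @ symmetric_word n E l @ [?a]"
    using True by (simp add: symmetric_word_def)
  have wt: "weight (istep ?a y) = weight y + 4" by (rule weight_istep[OF y a asc[OF True]])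
  show ?thesis
  proof (cases "y ?a = ?a \<and> y (Suc ?a) = Suc ?a")
    case fx: True
    then have "symmetric_word n E (l @ [c]) = symmetric_word n E l @ [?a]" using w sym True by simp
    moreover have "len (y \<circ> simple_refl ?a) = Suc (len y)"
      using len_ascent[OF finite_invs[of y n] asc[OF True]] y by (simp add: Invol_iff)
    ultimately show ?thesis
      using istep_cases(1)[OF y a asc[OF True] fx] wt y1 y2 y3
      unfolding balanced_def as' by (simp add: word_prod_append y_def)
  next
    case nfix: False
    then have "symmetric_word n E (l @ [c]) = [?a] @ symmetric_word n E l @ [?a]" using w sym True by simp
    moreover have "istep ?a y = simple_refl ?a \<circ> y \<circ> simple_refl ?a"
      and "len (simple_refl ?a \<circ> y \<circ> simple_refl ?a) = len y + 2"
      using istep_cases(2)[OF y a asc[OF True] nfix] by metis+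
    ultimately show ?thesis
      using wt y1 y2 y3
      unfolding balanced_def as' by (simp add: word_prod_append y_def comp_assoc)
  qed
qed

section \<open>Listings symmetric about the diagonal\<close>

definition lower_listing :: "nat \<Rightarrow> (nat \<times> nat) list \<Rightarrow> bool" where
  "lower_listing n ls \<longleftrightarrow> distinct ls \<and> set ls = {(j, i) \<in> grid n. i < j} \<and>
     sorted_wrt (\<lambda>s t. \<not> le_NE t s) ls"

definition full_listing :: "nat \<Rightarrow> (nat \<times> nat) list \<Rightarrow> (nat \<times> nat) list" where
  "full_listing n ls = rev (map prod.swap ls) @ diag_cells n @ ls"

lemma ex_lower_listing: "\<exists>ls. lower_listing n ls"
proof -
  obtain cs where "listing n cs"
    using ex_reading_order[of n] reading_word_eq[of n _ "{}"] by blast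
  then have "lower_listing n (filter (\<lambda>(j, i). i < j) cs)"
    by (auto simp: listing_def lower_listing_def intro: sorted_wrt_filter)
  then show ?thesis by blast
qed

text \<open>Diagonal cells are pairwise incomparable, no cell on or below the diagonal is NE of one
  above it, and no cell below the diagonal is NE of one on it.\<close>

lemma listing_full_listing:
  assumes "lower_listing n ls"
  shows "listing n (full_listing n ls)"
proof -
  have ls: "distinct ls" "set ls = {(j, i) \<in> grid n. i < j}" "sorted_wrt (\<lambda>s t. \<not> le_NE t s) ls"
    using assms by (auto simp: lower_listing_def)
  have up: "set (map prod.swap ls) = {(i, j) \<in> grid n. i < j}"
    by (auto simp: ls(2) grid_def image_iff)
  have dg: "set (diag_cells n) = {(i, j) \<in> grid n. i = j}"
    by (auto simp: diag_cells_def grid_def)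
  have "distinct (diag_cells n)"
    by (simp add: diag_cells_def distinct_map inj_on_def del: upt_Suc)
  then have "distinct (full_listing n ls)"
    unfolding full_listing_def using ls(1) up dg ls(2) by (auto simp: distinct_map)
  moreover have "set (full_listing n ls) = grid n"
    unfolding full_listing_def set_append set_rev up dg ls(2) by auto
  moreover have "sorted_wrt (\<lambda>s t. \<not> le_NE t s) (full_listing n ls)"
  proof -
    have "sorted_wrt (\<lambda>s t. \<not> le_NE t s) (rev (map prod.swap ls))"
      unfolding sorted_wrt_rev sorted_wrt_map
      by (rule sorted_wrt_mono_rel[OF _ ls(3)]) (simp add: le_NE_def conj_commute)
    moreover have "sorted_wrt (\<lambda>s t. \<not> le_NE t s) (diag_cells n)"
      unfolding diag_cells_def sorted_wrt_map
      by (rule sorted_wrt_mono_rel[OF _ sorted_wrt_upt]) (simp add: le_NE_def)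
    moreover have "\<forall>s\<in>set (map prod.swap ls). \<forall>t\<in>set (diag_cells n) \<union> set ls. \<not> le_NE t s"
      unfolding up dg ls(2) by (auto simp: le_NE_def)
    moreover have "\<forall>s\<in>set (diag_cells n). \<forall>t\<in>set ls. \<not> le_NE t s"
      unfolding dg ls(2) by (auto simp: le_NE_def)
    ultimately show ?thesis
      using ls(3) unfolding full_listing_def sorted_wrt_append set_append set_rev by blast
  qed
  ultimately show ?thesis by (simp add: listing_def)
qed

lemma balanced_append:
  assumes "E \<subseteq> stair n"
    and "\<And>l c r. ls = l @ c # r \<Longrightarrow> balanced n E l \<Longrightarrow> balanced n E (l @ [c])"
  shows "ls = l @ r \<Longrightarrow> balanced n E l"
proof (induction l arbitrary: r rule: rev_induct)
  case Nil
  show ?case by (rule balanced_Nil[OF assms(1)])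
next
  case (snoc c l)
  then show ?case using assms(2)[of l c r] by simp
qed

text \<open>The pipes through \<open>(j, i)\<close> are read off the suffix \<open>v\<close> of the word, and those through
  \<open>(i, j)\<close> off the longer suffix \<open>y s v\<close>. Hence they agree if and only if \<open>y\<close> preserves the pair
  of values which \<open>s\<close> exchanges.\<close>

lemma pipes_meet_transpose_iff:
  assumes ls: "lower_listing n ls" "ls = l @ c # r" and E: "E \<subseteq> stair n" "c \<in> E" "prod.swap c \<notin> E"
  defines "y \<equiv> word_prod (symmetric_word n E l)" and "a \<equiv> letter c"
  shows "(\<forall>p\<in>{1..n}. \<forall>q\<in>{1..n}. pipes_cross n E p q c \<longrightarrow> pipes_avoid n E p q (prod.swap c))
    \<longleftrightarrow> {y a, y (Suc a)} = {a, Suc a}"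
proof -
  let ?v = "word_prod (cells_word E r)" and ?s = "simple_refl a"
  have list: "listing n (full_listing n ls)" by (rule listing_full_listing[OF ls(1)])
  have cs: "c \<in> stair n" and cs': "prod.swap c \<in> stair n" and ca: "a \<in> {1..<n}"
    using E letter_stair a_def by (auto simp: stair_def grid_def)
  have "full_listing n ls = (rev (map prod.swap ls) @ diag_cells n @ l) @ c # r"
    by (simp add: full_listing_def ls)
  then have meet: "pipes_meet n E p q c \<longleftrightarrow> {?v p, ?v q} = {a, Suc a}" for p q
    using pipes_meet_iff[of n "rev (map prod.swap ls) @ diag_cells n @ l" c r E] list E(1) cs
    by (simp add: a_def)
  let ?r = "rev (map prod.swap l) @ diag_cells n @ l @ c # r"
  have "word_prod (cells_word E ?r) = y \<circ> ?s \<circ> ?v"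
    using E(2) by (simp add: y_def symmetric_word_def word_prod_append a_def comp_assoc)
  moreover have "full_listing n ls = rev (map prod.swap r) @ prod.swap c # ?r"
    by (simp add: full_listing_def ls)
  ultimately have meet': "pipes_meet n E p q (prod.swap c) \<longleftrightarrow>
      {y (?s (?v p)), y (?s (?v q))} = {a, Suc a}" for p q
    using pipes_meet_iff[of n "rev (map prod.swap r)" "prod.swap c" ?r E] list E(1) cs'
    by (simp add: a_def o_apply)
  have iff: "(pipes_cross n E p q c \<longrightarrow> pipes_avoid n E p q (prod.swap c)) \<longleftrightarrow>
      ({?v p, ?v q} = {a, Suc a} \<longrightarrow> {y (?s (?v p)), y (?s (?v q))} = {a, Suc a})" for p q
    using E(2,3) meet meet' by (simp add: pipes_cross_def pipes_avoid_def)
  have "set r \<subseteq> grid n" using ls by (auto simp: lower_listing_def)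
  then have "set (cells_word E r) \<subseteq> {1..<n}"
    using E(1) by (intro set_cells_word_subset(1)) (auto simp: stair_def)
  then have v: "?v \<in> Sym n" by (rule word_prod_in_Sym)
  show ?thesis
    unfolding iff
  proof
    assume *: "{y a, y (Suc a)} = {a, Suc a}"
    show "\<forall>p\<in>{1..n}. \<forall>q\<in>{1..n}. {?v p, ?v q} = {a, Suc a} \<longrightarrow>
        {y (?s (?v p)), y (?s (?v q))} = {a, Suc a}"
    proof (intro ballI impI)
      fix p q assume "{?v p, ?v q} = {a, Suc a}"
      then have "?v p = a \<and> ?v q = Suc a \<or> ?v p = Suc a \<and> ?v q = a" by (auto simp: doubleton_eq_iff)
      then show "{y (?s (?v p)), y (?s (?v q))} = {a, Suc a}"
        using * by (auto simp: simple_refl_apply insert_commute)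
    qed
  next
    assume *: "\<forall>p\<in>{1..n}. \<forall>q\<in>{1..n}. {?v p, ?v q} = {a, Suc a} \<longrightarrow>
        {y (?s (?v p)), y (?s (?v q))} = {a, Suc a}"
    \<comment> \<open>The hypothesis is instantiated with the two pipes that actually cross at
      \<open>c\<close>.\<close>
    have "inv ?v a \<in> {1..n}" "inv ?v (Suc a) \<in> {1..n}"
      using Sym_inv[OF v] permutes_in_image[of "inv ?v" "{1..n}"] ca by (auto simp: Sym_def)
    moreover have "?v (inv ?v x) = x" for x using Sym_bij[OF v] by (simp add: bij_is_surj surj_f_inv_f)
    ultimately have "{y (?s a), y (?s (Suc a))} = {a, Suc a}" using * by metis
    then show "{y a, y (Suc a)} = {a, Suc a}" by (simp add: simple_refl_apply insert_commute)
  qed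
qed

lemma almost_symmetric_iff:
  "almost_symmetric n E \<longleftrightarrow>
    (\<forall>c. snd c < fst c \<longrightarrow> (prod.swap c \<in> E \<longrightarrow> c \<in> E) \<and>
      (c \<in> E \<and> prod.swap c \<notin> E \<longrightarrow>
        (\<forall>p\<in>{1..n}. \<forall>q\<in>{1..n}. pipes_cross n E p q c \<longrightarrow> pipes_avoid n E p q (prod.swap c))))"
  unfolding almost_symmetric_def by (auto simp: split_paired_all)

lemma lower_triangle_restrict:
  assumes ls: "lower_listing n ls" and D: "D = E \<inter> lower_triangle n"
  shows "cells_word D (full_listing n ls) = cells_word E (diag_cells n @ ls)"
proof -
  have lsg: "set ls = {(j, i) \<in> grid n. i < j}" using ls by (simp add: lower_listing_def)
  have low: "set (diag_cells n @ ls) \<subseteq> lower_triangle n"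
    unfolding set_append lsg by (auto simp: diag_cells_def lower_triangle_def grid_def)
  have "filter (\<lambda>c. c \<in> D) (diag_cells n @ ls) = filter (\<lambda>c. c \<in> E) (diag_cells n @ ls)"
  proof (rule filter_cong[OF refl])
    show "c \<in> D \<longleftrightarrow> c \<in> E" if "c \<in> set (diag_cells n @ ls)" for c
      unfolding D using that low by blast
  qed
  moreover have "filter (\<lambda>c. c \<in> D) (rev (map prod.swap ls)) = []"
    unfolding filter_empty_conv set_rev set_map lsg D by (auto simp: lower_triangle_def)
  ultimately show ?thesis by (simp add: cells_word_def full_listing_def)
qed

section \<open>Lower triangular sets and involution words\<close>

lemma full_listing_word:
  "cells_word E (full_listing n ls) = symmetric_word n E ls"
  by (simp add: full_listing_def symmetric_word_def)

text \<open>Reducedness of the word of \<open>E\<close> gives the ascents required for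
  \<open>balanced\<close>; together with almost-symmetry it decides which transposed cells are
  present.\<close>

lemma ID_imp_involution_word:
  assumes z: "z \<in> Invol n" and ls: "lower_listing n ls"
    and E: "E \<in> PD n z" "almost_symmetric n E"
  shows "involution_word n z (cells_word (E \<inter> lower_triangle n) (full_listing n ls))"
proof -
  let ?w = "symmetric_word n E"
  have list: "listing n (full_listing n ls)" by (rule listing_full_listing[OF ls])
  have Es: "E \<subseteq> stair n" using E(1) by (simp add: PD_def reduced_pipe_dream_def stair_def)
  have Eg: "E \<subseteq> grid n" using Es by (auto simp: stair_def)
  have red: "len z = length (?w ls)" "word_prod (?w ls) = z"
    using E(1) z PD_iff[OF list Eg] by (auto simp: full_listing_word Invol_iff)
  have letters: "set (cells_word E cs) \<subseteq> {1..<n}" if "set cs \<subseteq> grid n" for cs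
    using that Es Eg by (intro set_cells_word_subset(1))
  have word: "set (?w ls) \<subseteq> {1..<n}"
    unfolding full_listing_word[symmetric] using list by (intro letters) (simp add: listing_def)
  have lsg: "set ls = {(j, i) \<in> grid n. i < j}" using ls by (simp add: lower_listing_def)
  have "balanced n E ls"
  proof (rule balanced_append[OF Es, where ls = ls and r = "[]"])
    fix l c r assume lcr: "ls = l @ c # r" and bal: "balanced n E l"
    let ?a = "letter c" and ?y = "word_prod (?w l)"
    have "c \<in> set ls" using lcr by simp
    then have c: "c \<in> grid n" "snd c < fst c" unfolding lsg by auto
    have lg: "set l \<subseteq> grid n" using lcr lsg by auto
    have as: "set (cells_word E (diag_cells n @ l)) \<subseteq> {1..<n}"
      using lg by (intro letters) (auto simp: diag_cells_def grid_def)
    have y: "?y \<in> Invol n"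
      using isteps_in_Invol[OF id_in_Invol as] bal by (simp add: balanced_def Let_def)
    have yS: "?y \<in> Sym n" using y by (simp add: Invol_iff)
    have ly: "len ?y = length (?w l)" using bal by (simp add: balanced_def Let_def)
    have dec: "?w ls = cells_word E (rev (map prod.swap r)) @
        ((if prod.swap c \<in> E then [?a] else []) @ ?w l @ (if c \<in> E then [?a] else [])) @ cells_word E r"
      by (simp add: symmetric_word_def lcr)
    have red_mid: "len (word_prod ((if prod.swap c \<in> E then [?a] else []) @ ?w l @ (if c \<in> E then [?a] else [])))
      = length ((if prod.swap c \<in> E then [?a] else []) @ ?w l @ (if c \<in> E then [?a] else []))" (is "len (word_prod ?m) = _")
      using reduced_factor[of "cells_word E (rev (map prod.swap r))" ?m "cells_word E r" n] word red
      unfolding dec[symmetric] by simp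
    have m: "set ?m \<subseteq> {1..<n}" using word dec by simp
    show "balanced n E (l @ [c])"
    proof (rule balanced_snoc[OF bal Es lg])
      show "prod.swap c \<in> E \<Longrightarrow> c \<in> E" using E(2) c unfolding almost_symmetric_iff by blast
    next
      assume cE: "c \<in> E"
      then have a: "?a \<in> {1..<n}" using Es letter_stair by blast
      have "len (word_prod (?w l @ [?a])) = length (?w l @ [?a])"
        using reduced_factor[of "if prod.swap c \<in> E then [?a] else []" "?w l @ [?a]" "[]" n] red_mid m cE by simp
      then have "len (?y \<circ> simple_refl ?a) = Suc (len ?y)" using ly by (simp add: word_prod_append)
      then show asc: "?y ?a < ?y (Suc ?a)"
        using len_descent[OF yS a] Sym_neq_Suc[OF yS, of ?a] by (metis linorder_neqE_nat n_not_Suc_n Suc_n_not_le_n lessI order_less_asym)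
      show "prod.swap c \<in> E \<longleftrightarrow> \<not> (?y ?a = ?a \<and> ?y (Suc ?a) = Suc ?a)"
      proof (cases "prod.swap c \<in> E")
        case True
        \<comment> \<open>If \<open>?y\<close> fixed both points, the two outer letters would cancel
          in the factor \<open>?m\<close>, which is reduced.\<close>
        have "?y ?a = ?a \<and> ?y (Suc ?a) = Suc ?a \<Longrightarrow> False"
        proof -
          assume fx: "?y ?a = ?a \<and> ?y (Suc ?a) = Suc ?a"
          then have "simple_refl ?a \<circ> ?y = ?y \<circ> simple_refl ?a"
            using istep_cases(1)[OF y a asc] by blast
          then have "simple_refl ?a \<circ> (?y \<circ> simple_refl ?a) = ?y"
            by (metis comp_assoc simple_refl_comp_self comp_id)
          then have "word_prod ?m = ?y" using True cE by (simp add: word_prod_append)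
          then show False using red_mid ly True cE by simp
        qed
        then show ?thesis using True by blast
      next
        case False
        then have "{?y ?a, ?y (Suc ?a)} = {?a, Suc ?a}"
          using pipes_meet_transpose_iff[OF ls lcr Es cE False] E(2) c cE
          unfolding almost_symmetric_iff by blast
        \<comment> \<open>The pair is preserved by almost-symmetry, and the ascent rules out that
          its points are exchanged.\<close>
        then have "?y ?a = ?a \<and> ?y (Suc ?a) = Suc ?a" using asc by (auto simp: doubleton_eq_iff)
        then show ?thesis using False by blast
      qed
    qed
  qed simp
  moreover have "set (cells_word E (diag_cells n @ ls)) \<subseteq> {1..<n}"
  proof (rule letters)
    show "set (diag_cells n @ ls) \<subseteq> grid n"
      unfolding set_append lsg by (auto simp: diag_cells_def grid_def)
  qed
  ultimately show ?thesis
    unfolding lower_triangle_restrict[OF ls refl] balanced_def Let_def red(2)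
    by (simp only: involution_word_iff_weight)
qed

lemma involution_word_imp_ID:
  assumes z: "z \<in> Invol n" and ls: "lower_listing n ls" and Dl: "D \<subseteq> lower_triangle n"
    and iw: "involution_word n z (cells_word D (full_listing n ls))"
  shows "D \<in> ID n z"
proof -
  have list: "listing n (full_listing n ls)" by (rule listing_full_listing[OF ls])
  have lsg: "set ls = {(j, i) \<in> grid n. i < j}" "distinct ls" using ls by (auto simp: lower_listing_def)
  have Dg: "D \<subseteq> grid n" using Dl by (auto simp: lower_triangle_def)
  have Ds: "D \<subseteq> stair n"
    using set_cells_word_subset(2)[OF Dg, of "full_listing n ls"] list iw
    by (simp add: listing_def involution_word_def)
  \<comment> \<open>\<open>Y c\<close> is the involution built before \<open>c\<close> is read. It
    uses only cells of \<open>D\<close>, hence can be used to define \<open>E\<close>, which adds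
    the transpose of \<open>c\<close> exactly when the step at \<open>c\<close> is a
    conjugation.\<close>
  define Y where "Y c = fold istep (cells_word D (diag_cells n @ takeWhile (\<lambda>d. d \<noteq> c) ls)) id" for c
  define E where "E = D \<union> prod.swap ` {c \<in> D \<inter> set ls.
    \<not> (Y c (letter c) = letter c \<and> Y c (Suc (letter c)) = Suc (letter c))}"
  have Es: "E \<subseteq> stair n" using Ds by (auto simp: E_def stair_def grid_def)
  have ED: "D = E \<inter> lower_triangle n"
    using Dl lsg(1) by (auto simp: E_def lower_triangle_def)
  have inE: "c \<in> E \<longleftrightarrow> c \<in> D" 
    "prod.swap c \<in> E \<longleftrightarrow> c \<in> D \<and> \<not> (Y c (letter c) = letter c \<and> Y c (Suc (letter c)) = Suc (letter c))"
    if "c \<in> set ls" for c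
    using that Dl lsg(1) by (auto simp: E_def lower_triangle_def)
  have full: "cells_word D (full_listing n ls) = cells_word E (diag_cells n @ ls)"
    by (rule lower_triangle_restrict[OF ls ED])
  have letters: "set (cells_word E cs) \<subseteq> {1..<n}" if "set cs \<subseteq> grid n" for cs
    using that Es by (intro set_cells_word_subset(1)) (auto simp: stair_def)
  have Dls: "set (diag_cells n @ ls) \<subseteq> grid n"
    unfolding set_append lsg(1) by (auto simp: diag_cells_def grid_def)
  have low: "set (diag_cells n @ ls) \<subseteq> lower_triangle n"
    unfolding set_append lsg(1) by (auto simp: diag_cells_def lower_triangle_def grid_def)
  have D_word: "cells_word D (diag_cells n @ l) = cells_word E (diag_cells n @ l)" if "set l \<subseteq> set ls" for l
  proof -
    have "filter (\<lambda>c. c \<in> D) (diag_cells n @ l) = filter (\<lambda>c. c \<in> E) (diag_cells n @ l)"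
    proof (rule filter_cong[OF refl])
      show "c \<in> D \<longleftrightarrow> c \<in> E" if "c \<in> set (diag_cells n @ l)" for c
        using that \<open>set l \<subseteq> set ls\<close> low ED by auto
    qed
    then show ?thesis by (simp add: cells_word_def)
  qed
  have zw: "z = fold istep (cells_word E (diag_cells n @ ls)) id"
    "weight z = 4 * length (cells_word E (diag_cells n @ ls))"
    using iw involution_word_iff_weight[OF letters[OF Dls]] unfolding full by auto
  have Y: "Y c = fold istep (cells_word E (diag_cells n @ l)) id" if "ls = l @ c # r" for l c r
  proof -
    have "takeWhile (\<lambda>d. d \<noteq> c) ls = l" using that lsg(2) by (auto simp: takeWhile_append)
    moreover have "set l \<subseteq> set ls" using that by auto
    ultimately show ?thesis unfolding Y_def using D_word by simp
  qed
  have step: "balanced n E (l @ [c])" if lcr: "ls = l @ c # r" and bal: "balanced n E l" for l c r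
  proof -
    let ?a = "letter c" and ?y = "word_prod (symmetric_word n E l)"
    have y: "?y = Y c" using bal Y[OF lcr] by (simp add: balanced_def Let_def)
    have c: "c \<in> set ls" and lg: "set l \<subseteq> grid n" using lcr lsg by auto
    show ?thesis
    proof (rule balanced_snoc[OF bal Es lg])
      show "prod.swap c \<in> E \<Longrightarrow> c \<in> E" using inE[OF c] by blast
    next
      assume cE: "c \<in> E"
      then have a: "?a \<in> {1..<n}" using Es letter_stair by blast
      let ?as = "cells_word E (diag_cells n @ l)"
      have dec: "cells_word E (diag_cells n @ ls) = (?as @ [?a]) @ cells_word E r" using cE lcr by simp
      have as: "set ((?as @ [?a]) @ cells_word E r) \<subseteq> {1..<n}"
        using letters[OF Dls] unfolding dec .
      \<comment> \<open>Both the prefix ending before \<open>c\<close> and the one ending with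
        \<open>c\<close> attain maximal weight. The letter of \<open>c\<close> therefore changes the
        involution and must be an ascent.\<close>
      have w1: "weight (fold istep (?as @ [?a]) id) = 4 * length (?as @ [?a])"
        by (rule weight_prefix[OF as]) (use zw in \<open>simp only: dec\<close>)
      have w0: "weight (fold istep ?as id) = 4 * length ?as"
        by (rule weight_prefix[OF _ w1]) (use as in auto)
      have Yi: "Y c \<in> Invol n" unfolding Y[OF lcr] by (rule isteps_in_Invol) (use as in auto)
      have "weight (istep ?a (Y c)) \<noteq> weight (Y c)" using w0 w1 unfolding Y[OF lcr] by simp
      then show "?y ?a < ?y (Suc ?a)" unfolding y using istep_cases(3)[OF Yi a] by metis
      show "prod.swap c \<in> E \<longleftrightarrow> \<not> (?y ?a = ?a \<and> ?y (Suc ?a) = Suc ?a)"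
        unfolding y using inE[OF c] cE by blast
    qed
  qed
  have bal: "balanced n E l" if "ls = l @ r" for l r
    by (rule balanced_append[OF Es _ that]) (rule step)
  have "E \<in> PD n z"
    using bal[of ls "[]"] PD_iff[OF list, of E z] Es z zw(1)
    by (auto simp: full_listing_word balanced_def Let_def Invol_iff stair_def)
  moreover have "almost_symmetric n E"
    unfolding almost_symmetric_iff
  proof (intro allI impI conjI)
    fix c :: "nat \<times> nat" assume c: "snd c < fst c" "prod.swap c \<in> E"
    then have "c \<in> set ls" using Es lsg(1) by (auto simp: stair_def grid_def)
    then show "c \<in> E" using inE[of c] c by blast
  next
    fix c :: "nat \<times> nat" assume c: "snd c < fst c" and cE: "c \<in> E \<and> prod.swap c \<notin> E"
    then have cls: "c \<in> set ls" using Es lsg(1) by (auto simp: stair_def)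
    then obtain l r where lcr: "ls = l @ c # r" by (meson split_list)
    have y: "word_prod (symmetric_word n E l) = Y c"
      using bal[OF lcr] Y[OF lcr] by (simp add: balanced_def Let_def)
    have "Y c (letter c) = letter c \<and> Y c (Suc (letter c)) = Suc (letter c)"
      using inE[OF cls] cE by blast
    then show "\<forall>p\<in>{1..n}. \<forall>q\<in>{1..n}. pipes_cross n E p q c \<longrightarrow> pipes_avoid n E p q (prod.swap c)"
      using pipes_meet_transpose_iff[OF ls lcr Es] cE y by simp
  qed
  ultimately show ?thesis using ED unfolding ID_def by blast
qed

theorem theorem3p9:
  fixes n :: nat and z :: "nat \<Rightarrow> nat" and D :: "(nat \<times> nat) set"
  assumes "n \<ge> 1" and "z \<in> Invol n" and "D \<subseteq> grid n"
  shows
    "((\<exists>\<omega>. reading_order n \<omega> \<and> involution_word n z (reading_word n \<omega> D)) \<longleftrightarrow>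
      (\<forall>\<omega>. reading_order n \<omega> \<longrightarrow> involution_word n z (reading_word n \<omega> D))) \<and>
     ((\<forall>\<omega>. reading_order n \<omega> \<longrightarrow> involution_word n z (reading_word n \<omega> D)) \<longleftrightarrow>
      (\<exists>w. atom n z w \<and> D \<in> PD n w)) \<and>
     (D \<subseteq> lower_triangle n \<longrightarrow>
      (D \<in> ID n z \<longleftrightarrow> (\<exists>w. atom n z w \<and> D \<in> PD n w)))"
proof -
  have reading: "involution_word n z (reading_word n \<omega> D) \<longleftrightarrow> (\<exists>w. atom n z w \<and> D \<in> PD n w)"
    if "reading_order n \<omega>" for \<omega>
    using reading_word_eq[OF that assms(3)] involution_word_cells_word_iff[OF _ assms(3)] by metis
  obtain ls where ls: "lower_listing n ls" using ex_lower_listing by blast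
  have "D \<in> ID n z \<longleftrightarrow> (\<exists>w. atom n z w \<and> D \<in> PD n w)" if "D \<subseteq> lower_triangle n"
  proof -
    have "D \<in> ID n z \<longleftrightarrow> involution_word n z (cells_word D (full_listing n ls))"
      using ID_imp_involution_word[OF assms(2) ls] involution_word_imp_ID[OF assms(2) ls that]
      unfolding ID_def by blast
    then show ?thesis
      using involution_word_cells_word_iff[OF listing_full_listing[OF ls] assms(3)] by blast
  qed
  \<comment> \<open>Some reading order must exist, for otherwise (b) would hold vacuously and (a)
    would fail.\<close>
  then show ?thesis using reading ex_reading_order[of n] by blast
qed

end
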